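(* Let $K$ be a stable policy and let $N\ge1$. Let $\theta^{(0)}\in\mathbb R^{1+n^2}$ and let $$\theta^{(s)}=\theta^{(s-1)}-\alpha\,\bar h(\theta^{(s-1)}),\quad s=1,\dots,N-1,\qquad \alpha=\frac{1-\gamma}{2(1+(n+2)\|D_K\|_F^2)},$$ be the TD-learning iterates with the semi-gradient update, and let $\tilde\theta=\frac1N\sum_{s=0}^{N-1}\theta^{(s)}$. Assume that there is $M_\theta>0$ such that $\|\theta^\star\|_2\le M_\theta$ and $\|\theta^{(s)}\|_2\le M_\theta$ for all $s$. Then $$\mathbb E_{x\sim\mu_K}\left[(\widetilde V(x;\tilde\theta)-\widetilde V(x;\theta^\star))^2\right]\le\frac{8(1+(n+2)\|D_K\|_F^2)M_\theta^2}{(1-\gamma)^2N}.$$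
   Context: Setting. $A\in\mathbb R^{n\times n}$, $B\in\mathbb R^{n\times d}$; $S\in\mathbb R^{n\times n}$ and $R\in\mathbb R^{d\times d}$ are symmetric positive definite; $\sigma>0$; $\gamma\in(0,1)$. Noise: $\omega\sim N(0,D_\omega)$ with $D_\omega$ positive definite and $\eta\sim N(0,\sigma^2I_d)$ are independent; $\widetilde\omega:=B\eta+\omega$, $D_{\widetilde\omega}:=\mathbb E[\widetilde\omega\widetilde\omega^\top]$. A policy is a matrix $K\in\mathbb R^{d\times n}$, giving the control $u=Kx+\eta$, next state $x'=Ax+Bu+\omega=(A+BK)x+\widetilde\omega$ and cost $c(x,u)=x^\top Sx+u^\top Ru$. $K$ is stable if the spectral radius of $A+BK$ is $<1$. For stable $K$, $\mu_K=N(0,D_K)$ is the stationary state distribution, $D_K=\sum_{i\ge0}(A+BK)^iD_{\widetilde\omega}[(A+BK)^i]^\top$; i.e. $x\sim\mu_K$ (independent of $\eta,\omega$) implies $x'\sim\mu_K$. Features and value function: $\phi(x)=\begin{bmatrix}1\\ \mathrm{vec}(xx^\top)\end{bmatrix}\in\mathbb R^{1+n^2}$ (vec stacks columns), $\widetilde V(x;\theta)=\phi(x)^\top\theta$. With $P_{K,\gamma}=\sum_{i\ge0}\gamma^i[(A+BK)^i]^\top(S+K^\top RK)(A+BK)^i$, let $\theta^\star=\begin{bmatrix}\theta_0^\star\\ \mathrm{vec}(P_{K,\gamma})\end{bmatrix}$, $\theta_0^\star=\frac{\gamma}{1-\gamma}\mathrm{Tr}[P_{K,\gamma}D_{\widetilde\omega}]+\frac{\sigma^2\mathrm{Tr}[R]}{1-\gamma}$,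 so that $\widetilde V(\cdot;\theta^\star)$ is the value function $V_K$ (expected discounted cost from initial state $x$) of policy $K$. TD error and semi-gradient: $\tilde\delta(x,u,x';\theta)=\widetilde V(x;\theta)-c(x,u)-\gamma\widetilde V(x';\theta)$ and $\bar h(\theta)=\mathbb E[\phi(x)\,\tilde\delta(x,u,x';\theta)]$, the expectation being over independent $x\sim\mu_K$, $\eta\sim N(0,\sigma^2I_d)$, $\omega\sim N(0,D_\omega)$ with $u=Kx+\eta$, $x'=(A+BK)x+B\eta+\omega$. *)

theory Defs
  imports "HOL-Probability.Probability"
begin

section \<open>Matrices\<close>

definition sym_pos_def :: "real^'n^'n \<Rightarrow> bool" where
  "sym_pos_def M \<longleftrightarrow> transpose M = M \<and> (\<forall>x. x \<noteq> 0 \<longrightarrow> 0 < x \<bullet> (M *v x))"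

(* The overloaded power on real^'n^'n is componentwise, hence this separate matrix power. *)
primrec mat_power :: "real^'n^'n \<Rightarrow> nat \<Rightarrow> real^'n^'n" where
  "mat_power M 0 = mat 1"
| "mat_power M (Suc i) = M ** mat_power M i"

definition complex_eigenvalue :: "real^'n^'n \<Rightarrow> complex \<Rightarrow> bool" where
  "complex_eigenvalue M z \<longleftrightarrow>
     (\<exists>v::complex^'n. v \<noteq> 0 \<and> (\<chi> i j. complex_of_real (M $ i $ j)) *v v = z *s v)"

definition spec_radius :: "real^'n^'n \<Rightarrow> real" where
  "spec_radius M = Max (cmod ` {z. complex_eigenvalue M z})"

definition frobenius_norm :: "real^'n^'m \<Rightarrow> real" where
  "frobenius_norm M = sqrt (\<Sum>i\<in>UNIV. \<Sum>j\<in>UNIV. (M $ i $ j)\<^sup>2)"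

lemma frobenius_norm_eq_norm: "frobenius_norm M = norm M"
  by (simp add: frobenius_norm_def norm_vec_def L2_set_def sum_nonneg)

definition outer :: "real^'n \<Rightarrow> real^'m \<Rightarrow> real^'m^'n" where
  "outer x y = (\<chi> i j. x $ i * y $ j)"

(* R^(n^2) is indexed by pairs (column, row); under the lexicographic order of the pairs
   this is the stacking of the columns. *)
definition vec_cols :: "real^'n^'n \<Rightarrow> real^('n \<times> 'n)" where
  "vec_cols M = (\<chi> p. M $ snd p $ fst p)"


section \<open>Centred Gaussian distributions\<close>

(* N(0, D) for a positive definite covariance matrix D, given by its Lebesgue density. *)
definition gaussian :: "real^'n^'n \<Rightarrow> (real^'n) measure" where
  "gaussian D = density lborel (\<lambda>x. ennreal
     (exp (- (x \<bullet> (matrix_inv D *v x)) / 2) / sqrt ((2 * pi) ^ CARD('n) * det D)))"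


section \<open>Linear system with linear-Gaussian policy\<close>

definition stable_policy :: "real^'n^'n \<Rightarrow> real^'d^'n \<Rightarrow> real^'n^'d \<Rightarrow> bool" where
  "stable_policy A B K \<longleftrightarrow> spec_radius (A + B ** K) < 1"

definition eta_dist :: "real \<Rightarrow> (real^'d) measure" where
  "eta_dist \<sigma> = gaussian (\<sigma>\<^sup>2 *\<^sub>R mat 1)"

(* Joint law of the independent pair (eta, omega). *)
definition noise_dist :: "real \<Rightarrow> real^'n^'n \<Rightarrow> ((real^'d) \<times> (real^'n)) measure" where
  "noise_dist \<sigma> D\<^sub>\<omega> = eta_dist \<sigma> \<Otimes>\<^sub>M gaussian D\<^sub>\<omega>"

(* The covariance E[w w^T] of the total noise w = B eta + omega. *)
definition total_noise_cov :: "real^'d^'n \<Rightarrow> real \<Rightarrow> real^'n^'n \<Rightarrow> real^'n^'n" where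
  "total_noise_cov B \<sigma> D\<^sub>\<omega> =
     (\<integral>(\<eta>, \<omega>). outer (B *v \<eta> + \<omega>) (B *v \<eta> + \<omega>) \<partial>noise_dist \<sigma> D\<^sub>\<omega>)"

definition state_cov ::
    "real^'n^'n \<Rightarrow> real^'d^'n \<Rightarrow> real \<Rightarrow> real^'n^'n \<Rightarrow> real^'n^'d \<Rightarrow> real^'n^'n" where
  "state_cov A B \<sigma> D\<^sub>\<omega> K =
     (\<Sum>i. mat_power (A + B ** K) i ** total_noise_cov B \<sigma> D\<^sub>\<omega> **
          transpose (mat_power (A + B ** K) i))"

definition state_dist ::
    "real^'n^'n \<Rightarrow> real^'d^'n \<Rightarrow> real \<Rightarrow> real^'n^'n \<Rightarrow> real^'n^'d \<Rightarrow> (real^'n) measure" where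
  "state_dist A B \<sigma> D\<^sub>\<omega> K = gaussian (state_cov A B \<sigma> D\<^sub>\<omega> K)"

definition cost :: "real^'n^'n \<Rightarrow> real^'d^'d \<Rightarrow> real^'n \<Rightarrow> real^'d \<Rightarrow> real" where
  "cost S R x u = x \<bullet> (S *v x) + u \<bullet> (R *v u)"

definition value_matrix ::
    "real^'n^'n \<Rightarrow> real^'d^'n \<Rightarrow> real^'n^'n \<Rightarrow> real^'d^'d \<Rightarrow> real \<Rightarrow> real^'n^'d \<Rightarrow> real^'n^'n" where
  "value_matrix A B S R \<gamma> K =
     (\<Sum>i. \<gamma> ^ i *\<^sub>R (transpose (mat_power (A + B ** K) i) **
          (S + transpose K ** R ** K) ** mat_power (A + B ** K) i))"


section \<open>Features and TD-learning\<close>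

(* R^(1 + n^2) as R x R^(n^2); inner product and norm on the product type are Euclidean. *)
type_synonym 'n feat = "real \<times> (real^('n \<times> 'n))"

definition feature :: "real^'n \<Rightarrow> 'n feat" where
  "feature x = (1, vec_cols (outer x x))"

definition V_approx :: "real^'n \<Rightarrow> 'n feat \<Rightarrow> real" where
  "V_approx x \<theta> = feature x \<bullet> \<theta>"

definition theta_star ::
    "real^'n^'n \<Rightarrow> real^'d^'n \<Rightarrow> real^'n^'n \<Rightarrow> real^'d^'d \<Rightarrow> real \<Rightarrow> real \<Rightarrow> real^'n^'n \<Rightarrow>
     real^'n^'d \<Rightarrow> 'n feat" where
  "theta_star A B S R \<sigma> \<gamma> D\<^sub>\<omega> K =
     (\<gamma> / (1 - \<gamma>) * trace (value_matrix A B S R \<gamma> K ** total_noise_cov B \<sigma> D\<^sub>\<omega>) +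
        \<sigma>\<^sup>2 * trace R / (1 - \<gamma>),
      vec_cols (value_matrix A B S R \<gamma> K))"

definition td_error ::
    "real^'n^'n \<Rightarrow> real^'d^'d \<Rightarrow> real \<Rightarrow> real^'n \<Rightarrow> real^'d \<Rightarrow> real^'n \<Rightarrow> 'n feat \<Rightarrow> real" where
  "td_error S R \<gamma> x u x' \<theta> = V_approx x \<theta> - cost S R x u - \<gamma> * V_approx x' \<theta>"

definition semi_gradient ::
    "real^'n^'n \<Rightarrow> real^'d^'n \<Rightarrow> real^'n^'n \<Rightarrow> real^'d^'d \<Rightarrow> real \<Rightarrow> real \<Rightarrow> real^'n^'n \<Rightarrow>
     real^'n^'d \<Rightarrow> 'n feat \<Rightarrow> 'n feat" where
  "semi_gradient A B S R \<sigma> \<gamma> D\<^sub>\<omega> K \<theta> =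
     (\<integral>(x, \<eta>, \<omega>).
        td_error S R \<gamma> x (K *v x + \<eta>) ((A + B ** K) *v x + B *v \<eta> + \<omega>) \<theta> *\<^sub>R feature x
      \<partial>(state_dist A B \<sigma> D\<^sub>\<omega> K \<Otimes>\<^sub>M noise_dist \<sigma> D\<^sub>\<omega>))"

end

theory Submission
  imports Defs "HOL-Computational_Algebra.Fundamental_Theorem_Algebra"
begin

text \<open>
  Write \<open>F = A + B K\<close>, \<open>\<theta>'\<close> for \<open>theta_star\<close>, \<open>L = 1 + (n + 2) |D\<^sub>K|\<^sup>2\<close>, and for a parameter \<open>\<theta>\<close> let
  \<open>\<xi>\<close> and \<open>\<xi>'\<close> be the values of \<open>V_approx _ (\<theta> - \<theta>')\<close> at the state \<open>x\<close> and at its successor \<open>x'\<close>.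
  By the Bellman equation (\<open>bellman_residual_mean_zero\<close>) the mean update is \<open>h = E[(\<xi> - \<gamma> \<xi>') \<phi>(x)]\<close>.
  With \<open>e = E[\<xi>\<^sup>2]\<close> and \<open>c = E[\<xi> \<xi>']\<close> this gives \<open>h \<bullet> (\<theta> - \<theta>') = e - \<gamma> c\<close>, and Cauchy-Schwarz gives
  \<open>|h|\<^sup>2 \<le> E|\<phi>|\<^sup>2 ((1 + \<gamma>\<^sup>2) e - 2 \<gamma> c)\<close>, because \<open>E[\<xi>'\<^sup>2] = e\<close> by stationarity. The Gaussian fourth
  moments yield \<open>E|\<phi>|\<^sup>2 = 1 + (tr D\<^sub>K)\<^sup>2 + 2 |D\<^sub>K|\<^sup>2 \<le> L\<close>. For the given step size an update therefore
  decreases \<open>|\<theta> - \<theta>'|\<^sup>2\<close> by at least \<open>(1 - \<gamma>)\<^sup>2 e / (2 L)\<close> (\<open>td_descent\<close>). Here it matters that \<open>c\<close> is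
  kept in both terms: the case \<open>c = e\<close>, in which the inner product is smallest, is also the one
  where \<open>|h|\<close> is small. Summing over the iterates, the total error is at most \<open>2 L / (1 - \<gamma>)\<^sup>2\<close> times
  \<open>|\<theta>\<^sub>0 - \<theta>'|\<^sup>2 \<le> 4 M\<^sup>2\<close>, and convexity of the square passes to the average.

  Three ingredients have to be built. The series for \<open>D\<^sub>K\<close> and for the value matrix converge because the
  powers of a matrix of spectral radius below one decay geometrically (\<open>mat_power_geometric_decay\<close>,
  through an annihilating polynomial). The density \<open>gaussian D\<close> integrates to one and has the moment
  generating function \<open>exp (v\<^sup>T D v / 2)\<close> (\<open>gaussian_vector_gaussian\<close>, through a linear change of
  variables). Finally, the moment generating function determines the moments up to order four
  (\<open>gaussian_vector_fourth_moment\<close>); since it is preserved by \<open>x' = F x + B \<eta> + \<omega>\<close>, equality of the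
  second moments of \<open>\<xi>\<close> and \<open>\<xi>'\<close> follows without identifying the law of \<open>x'\<close> as a density.
\<close>

section \<open>Powers of a matrix of spectral radius less than one\<close>

definition cmat :: "real^'m^'n \<Rightarrow> complex^'m^'n" where
  "cmat M = (\<chi> i j. complex_of_real (M $ i $ j))"

lemma cmat_mult: "cmat (M ** P) = cmat M ** cmat P"
  by (simp add: cmat_def matrix_matrix_mult_def vec_eq_iff)

lemma cmat_mat_1: "cmat (mat 1) = mat 1"
  by (simp add: cmat_def mat_def vec_eq_iff)

lemma cmat_zero: "cmat 0 = 0"
  by (simp add: cmat_def vec_eq_iff)

lemma cmat_add: "cmat (M + P) = cmat M + cmat P"
  by (simp add: cmat_def vec_eq_iff)

lemma cmat_scaleR_vector: "cmat (c *\<^sub>R M) *v w = complex_of_real c *s (cmat M *v w)"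
  by (simp add: cmat_def vec_eq_iff matrix_vector_mult_def sum_distrib_left mult.assoc)

lemma cmat_power_vector: "cmat (mat_power M k) *v w = ((*v) (cmat M) ^^ k) w"
  by (induction k) (simp_all add: cmat_mat_1 cmat_mult flip: matrix_vector_mul_assoc)

lemma complex_eigenvalue_cmat:
  "complex_eigenvalue M z \<longleftrightarrow> (\<exists>v. v \<noteq> 0 \<and> cmat M *v v = z *s v)"
  by (simp add: complex_eigenvalue_def cmat_def)

text \<open>The action \<open>w \<mapsto> p(T) w\<close> of a complex polynomial in \<open>T\<close> on one vector. Horner's scheme avoids
  matrix powers over the complex numbers and makes every algebraic law a one-line induction.\<close>
definition poly_act :: "complex^'n^'n \<Rightarrow> complex poly \<Rightarrow> complex^'n \<Rightarrow> complex^'n" where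
  "poly_act T p w = fold_coeffs (\<lambda>a v. a *s w + T *v v) p 0"

lemma poly_act_0 [simp]: "poly_act T 0 w = 0"
  by (simp add: poly_act_def)

lemma poly_act_pCons: "poly_act T (pCons a p) w = a *s w + T *v poly_act T p w"
proof (cases "p = 0 \<and> a = 0")
  case True
  then show ?thesis by simp
next
  case False
  then show ?thesis
    by (cases "p = 0") (auto simp: poly_act_def fold_coeffs_pCons_eq fold_coeffs_pCons_coeff_not_0_eq fold_coeffs_pCons_not_0_0_eq)
qed

lemma poly_act_add: "poly_act T (p + q) w = poly_act T p w + poly_act T q w"
  by (induction p q rule: poly_induct2)
     (simp_all add: poly_act_pCons matrix_vector_right_distrib vector_sadd_rdistrib algebra_simps)

lemma matrix_vector_mult_smult: "(T::complex^'n^'m) *v (c *s w) = c *s (T *v w)"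
  by (simp add: vec_eq_iff matrix_vector_mult_def sum_distrib_left mult_ac)

lemma poly_act_smult: "poly_act T (smult c p) w = c *s poly_act T p w"
  by (induction p)
     (simp_all add: poly_act_pCons matrix_vector_mult_smult vector_add_ldistrib vector_smult_assoc)

lemma poly_act_sum: "poly_act T (\<Sum>k\<in>I. p k) w = (\<Sum>k\<in>I. poly_act T (p k) w)"
  by (induction I rule: infinite_finite_induct) (simp_all add: poly_act_add)

lemma poly_act_monom: "poly_act T (monom c k) w = c *s ((*v) T ^^ k) w"
  by (induction k)
     (simp_all add: monom_0 monom_Suc poly_act_pCons matrix_vector_mult_smult)

lemma poly_act_linear_factor_left:
  "poly_act T ([:-z, 1:] * q) w = T *v poly_act T q w - z *s poly_act T q w"
  using poly_act_add[of T "smult (-z) q" "pCons 0 q" w]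
  by (simp add: poly_act_smult poly_act_pCons vector_smult_lneg del: smult_minus_left)

lemma poly_act_vector_add: "poly_act T p (v + w) = poly_act T p v + poly_act T p w"
  by (induction p)
     (simp_all add: poly_act_pCons matrix_vector_right_distrib vector_add_ldistrib)

lemma poly_act_vector_smult: "poly_act T p (c *s w) = c *s poly_act T p w"
  by (induction p)
     (simp_all add: poly_act_pCons matrix_vector_mult_smult vector_add_ldistrib vector_smult_assoc mult.commute)

lemma poly_act_commute: "poly_act T p (T *v w) = T *v poly_act T p w"
  by (induction p)
     (simp_all add: poly_act_pCons matrix_vector_mult_smult matrix_vector_right_distrib)

lemma poly_act_linear_factor_right:
  "poly_act T ([:-z, 1:] * q) w = poly_act T q (T *v w - z *s w)"
proof -
  have "poly_act T q (T *v w + (-z) *s w) = T *v poly_act T q w + (-z) *s poly_act T q w"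
    by (simp only: poly_act_vector_add poly_act_commute poly_act_vector_smult)
  then show ?thesis
    by (simp add: poly_act_linear_factor_left del: mult_pCons_left)
qed

lemma poly_act_eigenvector:
  assumes "T *v v = z *s v"
  shows "poly_act T p v = poly p z *s v"
  by (induction p)
     (simp_all add: poly_act_pCons matrix_vector_mult_smult assms vector_smult_assoc vector_sadd_rdistrib mult.commute)

text \<open>The powers of \<open>M\<close> live in a real vector space of finite dimension, so they satisfy a linear
  relation.\<close>
lemma annihilating_polynomial:
  fixes M :: "real^'n^'n"
  obtains p where "p \<noteq> 0" "\<And>w. poly_act (cmat M) p w = 0"
proof -
  define m where "m = DIM(real^'n^'n)"
  obtain c :: "nat \<Rightarrow> real" where c: "\<exists>k\<le>m. c k \<noteq> 0" "(\<Sum>k\<le>m. c k *\<^sub>R mat_power M k) = 0"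
  proof (cases "inj_on (mat_power M) {..m}")
    case True
    have "card (mat_power M ` {..m}) > DIM(real^'n^'n)"
      using True by (simp add: card_image m_def)
    then have "dependent (mat_power M ` {..m})"
      using independent_bound by (meson leD)
    then obtain u v where u: "v \<in> mat_power M ` {..m}" "u v \<noteq> 0"
        "(\<Sum>v\<in>mat_power M ` {..m}. u v *\<^sub>R v) = 0"
      by (auto simp: dependent_finite)
    then show ?thesis
      using that[of "\<lambda>k. u (mat_power M k)"] by (auto simp: sum.reindex[OF True])
  next
    case False
    then obtain i j where ij: "i \<le> m" "j \<le> m" "i \<noteq> j" "mat_power M i = mat_power M j"
      by (auto simp: inj_on_def)
    have "(\<Sum>k\<le>m. (if k = i then 1 else if k = j then -1 else 0) *\<^sub>R mat_power M k)
        = (\<Sum>k\<le>m. (if k = i then mat_power M i else 0) - (if k = j then mat_power M j else 0))"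
      using ij by (intro sum.cong) auto
    also have "\<dots> = 0"
      using ij by (simp add: sum_subtractf)
    finally show ?thesis
      using ij by (intro that[of "\<lambda>k. if k = i then 1 else if k = j then -1 else 0"]) auto
  qed
  define p where "p = (\<Sum>k\<le>m. monom (complex_of_real (c k)) k)"
  have "coeff p k = (if k \<le> m then complex_of_real (c k) else 0)" for k
    by (simp add: p_def coeff_sum)
  then have "p \<noteq> 0"
    using c(1) by (metis coeff_0 of_real_eq_0_iff)
  moreover have "poly_act (cmat M) p w = 0" for w
  proof -
    have "poly_act (cmat M) p w = (\<Sum>k\<le>m. cmat (c k *\<^sub>R mat_power M k) *v w)"
      by (simp add: p_def poly_act_sum poly_act_monom cmat_scaleR_vector cmat_power_vector)
    also have "\<dots> = cmat (\<Sum>k\<le>m. c k *\<^sub>R mat_power M k) *v w"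
      by (induction m) (simp_all add: cmat_add matrix_vector_mult_add_rdistrib)
    finally show ?thesis by (simp add: c(2) cmat_zero)
  qed
  ultimately show ?thesis using that by blast
qed

text \<open>Every eigenvalue is a root of an annihilating polynomial. Finiteness is what makes the maximum
  in the definition of the spectral radius an upper bound.\<close>
lemma finite_complex_eigenvalues: "finite {z. complex_eigenvalue M z}"
proof -
  obtain p where p: "p \<noteq> 0" "\<And>w. poly_act (cmat M) p w = 0"
    using annihilating_polynomial[of M] by blast
  have "{z. complex_eigenvalue M z} \<subseteq> {z. poly p z = 0}"
    using p(2) by (auto simp: complex_eigenvalue_cmat vec_eq_iff poly_act_eigenvector)
       (metis vec_eq_iff p(2) poly_act_eigenvector vector_smult_component mult_eq_0_iff zero_index)
  then show ?thesis
    using poly_roots_finite[OF p(1)] finite_subset by blast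
qed

lemma eigenvalue_le_spec_radius:
  "complex_eigenvalue M z \<Longrightarrow> cmod z \<le> spec_radius M"
  unfolding spec_radius_def
  by (intro Max_ge) (auto intro: finite_complex_eigenvalues)

text \<open>Induction on the degree of a polynomial killing \<open>w\<close>: split off a factor \<open>X - z\<close>. If \<open>z\<close> is not an
  eigenvalue, \<open>T - z\<close> is injective and the factor can be dropped. If it is one, then
  \<open>u = (T - z) w\<close> is killed by a polynomial of smaller degree, and \<open>a\<^sub>k = |T\<^sup>k w|\<close> satisfies
  \<open>a\<^bsub>k+1\<^esub> \<le> |z| a\<^sub>k + C s\<^sup>k\<close> with \<open>|z| < s\<close>, which preserves a bound \<open>a\<^sub>k \<le> E s\<^sup>k\<close>.\<close>
lemma orbit_geometric_decay:
  fixes T :: "complex^'n^'n"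
  assumes eig: "\<And>z v. v \<noteq> 0 \<Longrightarrow> T *v v = z *s v \<Longrightarrow> cmod z < s"
    and "0 < s" and "p \<noteq> 0" and "poly_act T p w = 0"
  shows "\<exists>C. \<forall>k. norm (((*v) T ^^ k) w) \<le> C * s ^ k"
  using assms(3,4)
proof (induction "degree p" arbitrary: p w)
  case 0
  then obtain c where "p = [:c:]" by (metis degree_eq_zeroE)
  with 0 have "w = 0"
    by (auto simp: poly_act_pCons vec_eq_iff)
  moreover have "((*v) T ^^ k) 0 = 0" for k
    by (induction k) auto
  ultimately show ?case by (intro exI[of _ 0]) simp
next
  case (Suc m)
  obtain z where z: "poly p z = 0"
    using fundamental_theorem_of_algebra[of p] Suc.hyps(2) by (auto simp: constant_degree)
  then obtain q where q: "p = [:-z, 1:] * q"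
    by (auto simp: poly_eq_0_iff_dvd)
  with Suc.prems have "q \<noteq> 0" by auto
  then have "degree p = Suc (degree q)"
    unfolding q by (subst degree_mult_eq) auto
  then have deg: "m = degree q" using Suc.hyps(2) by simp
  show ?case
  proof (cases "\<exists>v. v \<noteq> 0 \<and> T *v v = z *s v")
    case False
    have "T *v poly_act T q w = z *s poly_act T q w"
      using Suc.prems(2) by (simp only: q poly_act_linear_factor_left) simp
    then have "poly_act T q w = 0" using False by blast
    then show ?thesis using Suc.hyps(1)[OF deg \<open>q \<noteq> 0\<close>] by blast
  next
    case True
    then have zs: "cmod z < s" using eig by blast
    define u where "u = T *v w - z *s w"
    have "poly_act T q u = 0"
      using Suc.prems(2) by (simp only: q poly_act_linear_factor_right u_def)
    then obtain C where C: "\<And>k. norm (((*v) T ^^ k) u) \<le> C * s ^ k"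
      using Suc.hyps(1)[OF deg \<open>q \<noteq> 0\<close>] by blast
    \<comment> \<open>The second entry is the fixed point of \<open>E \<mapsto> (|z| E + C) / s\<close>, the first one starts the induction.\<close>
    define E where "E = max (norm w) (C / (s - cmod z))"
    have E: "cmod z * E + C \<le> s * E"
    proof -
      have "C / (s - cmod z) \<le> E" by (simp add: E_def)
      then have "C \<le> E * (s - cmod z)" using zs by (simp add: pos_divide_le_eq)
      then show ?thesis by (simp add: algebra_simps)
    qed
    have pow_u: "((*v) T ^^ Suc k) w = z *s ((*v) T ^^ k) w + ((*v) T ^^ k) u" for k
      by (induction k)
         (simp_all add: u_def matrix_vector_right_distrib matrix_vector_mult_smult)
    have norm_smult: "norm (z *s v) = cmod z * norm v" for v :: "complex^'n"
      by (simp add: norm_vec_def norm_mult L2_set_right_distrib)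
    have "norm (((*v) T ^^ k) w) \<le> E * s ^ k" for k
    proof (induction k)
      case 0
      then show ?case by (simp add: E_def)
    next
      case (Suc k)
      have "norm (((*v) T ^^ Suc k) w) \<le> cmod z * norm (((*v) T ^^ k) w) + norm (((*v) T ^^ k) u)"
        unfolding pow_u by (metis norm_triangle_ineq norm_smult)
      also have "\<dots> \<le> cmod z * (E * s ^ k) + C * s ^ k"
        by (intro add_mono mult_left_mono Suc C) simp
      also have "\<dots> = (cmod z * E + C) * s ^ k" by (simp add: algebra_simps)
      also have "\<dots> \<le> s * E * s ^ k"
        using E \<open>0 < s\<close> by (intro mult_right_mono) auto
      finally show ?case by (simp add: mult_ac)
    qed
    then show ?thesis by blast
  qed
qed

lemma mat_power_geometric_decay:
  fixes M :: "real^'n^'n"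
  assumes "spec_radius M < 1"
  obtains s C where "0 < s" "s < 1" "\<And>k i j. \<bar>mat_power M k $ i $ j\<bar> \<le> C * s ^ k"
proof -
  \<comment> \<open>Any number strictly between the spectral radius and 1 works; the maximum keeps it positive.\<close>
  define s where "s = max (1/2) ((1 + spec_radius M) / 2)"
  have s: "0 < s" "s < 1" "spec_radius M < s"
    using assms by (auto simp: s_def less_max_iff_disj)
  obtain p where p: "p \<noteq> 0" "\<And>w. poly_act (cmat M) p w = 0"
    using annihilating_polynomial[of M] by blast
  have "cmod z < s" if "v \<noteq> 0" "cmat M *v v = z *s v" for z v
    using eigenvalue_le_spec_radius[of M z] s(3) that
    by (force simp: complex_eigenvalue_cmat)
  then have "\<exists>C. \<forall>k. norm (((*v) (cmat M) ^^ k) w) \<le> C * s ^ k" for w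
    using orbit_geometric_decay[OF _ s(1) p] by blast
  then obtain C where C: "\<And>w k. norm (((*v) (cmat M) ^^ k) w) \<le> C w * s ^ k"
    by metis
  define E where "E = (\<Sum>j\<in>UNIV. \<bar>C (axis j 1)\<bar>)"
  have "\<bar>mat_power M k $ i $ j\<bar> \<le> E * s ^ k" for k i j
  proof -
    have "\<bar>mat_power M k $ i $ j\<bar> = cmod ((cmat (mat_power M k) *v axis j 1) $ i)"
      by (simp add: cmat_def matrix_vector_mult_def axis_def if_distrib cong: if_cong)
    also have "\<dots> \<le> C (axis j 1) * s ^ k"
      using Finite_Cartesian_Product.norm_nth_le C order_trans
      unfolding cmat_power_vector by blast
    also have "\<dots> \<le> E * s ^ k"
    proof -
      have "C (axis j 1) \<le> \<bar>C (axis j 1)\<bar>" by simp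
      also have "\<dots> \<le> E"
        unfolding E_def by (rule member_le_sum) auto
      finally show ?thesis using s(1) by (intro mult_right_mono) auto
    qed
    finally show ?thesis .
  qed
  with s that show ?thesis by blast
qed


section \<open>Linear change of variables in Lebesgue integrals\<close>

text \<open>The change-of-variables formula for \<open>f\<close>, as a property that passes to compositions and so needs
  to be checked on elementary linear maps only.\<close>
definition scales_lborel :: "(real^'n \<Rightarrow> real^'n) \<Rightarrow> bool" where
  "scales_lborel f \<longleftrightarrow> (\<forall>g\<in>borel_measurable borel.
     (\<integral>\<^sup>+x. g x \<partial>lborel) = ennreal \<bar>det (matrix f)\<bar> * (\<integral>\<^sup>+x. g (f x) \<partial>lborel))"

lemma scales_lborelD:
  "scales_lborel f \<Longrightarrow> g \<in> borel_measurable borel \<Longrightarrow>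
     (\<integral>\<^sup>+x. g x \<partial>lborel) = ennreal \<bar>det (matrix f)\<bar> * (\<integral>\<^sup>+x. g (f x) \<partial>lborel)"
  unfolding scales_lborel_def by blast

lemma borel_measurable_linear:
  fixes f :: "real^'n \<Rightarrow> real^'m"
  assumes "linear f"
  shows "f \<in> borel_measurable borel"
  using assms linear_continuous_on[of f UNIV]
  by (simp add: borel_measurable_continuous_onI linear_conv_bounded_linear)

lemma scales_lborelI_measure_preserving:
  assumes "linear f" and "\<bar>det (matrix f)\<bar> = 1" and "distr lborel borel f = lborel"
  shows "scales_lborel f"
  unfolding scales_lborel_def
proof
  fix g :: "real^'a \<Rightarrow> ennreal" assume [measurable]: "g \<in> borel_measurable borel"
  have [measurable]: "f \<in> borel_measurable borel"
    using assms(1) by (rule borel_measurable_linear)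
  have "(\<integral>\<^sup>+x. g x \<partial>lborel) = (\<integral>\<^sup>+x. g x \<partial>distr lborel borel f)"
    by (simp add: assms(3))
  also have "\<dots> = (\<integral>\<^sup>+x. g (f x) \<partial>lborel)"
    by (subst nn_integral_distr) auto
  finally show "(\<integral>\<^sup>+x. g x \<partial>lborel) = ennreal \<bar>det (matrix f)\<bar> * (\<integral>\<^sup>+x. g (f x) \<partial>lborel)"
    by (simp add: assms(2))
qed

lemma scales_lborel_compose:
  assumes "linear f" "linear g" "scales_lborel f" "scales_lborel g"
  shows "scales_lborel (f \<circ> g)"
  unfolding scales_lborel_def
proof
  fix h :: "real^'a \<Rightarrow> ennreal" assume [measurable]: "h \<in> borel_measurable borel"
  have [measurable]: "f \<in> borel_measurable borel"
    using assms(1) by (rule borel_measurable_linear)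
  have "(\<integral>\<^sup>+x. h x \<partial>lborel) = ennreal \<bar>det (matrix f)\<bar> * (\<integral>\<^sup>+x. h (f x) \<partial>lborel)"
    using assms(3) by (rule scales_lborelD) measurable
  also have "(\<integral>\<^sup>+x. h (f x) \<partial>lborel) = ennreal \<bar>det (matrix g)\<bar> * (\<integral>\<^sup>+x. h (f (g x)) \<partial>lborel)"
    using assms(4) by (rule scales_lborelD) measurable
  also have "ennreal \<bar>det (matrix f)\<bar> * (ennreal \<bar>det (matrix g)\<bar> * (\<integral>\<^sup>+x. h (f (g x)) \<partial>lborel))
      = ennreal \<bar>det (matrix (f \<circ> g))\<bar> * (\<integral>\<^sup>+x. h ((f \<circ> g) x) \<partial>lborel)"
    unfolding matrix_compose[OF assms(2,1)] det_mul abs_mult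
    by (simp add: ennreal_mult mult.assoc)
  finally show "(\<integral>\<^sup>+x. h x \<partial>lborel)
      = ennreal \<bar>det (matrix (f \<circ> g))\<bar> * (\<integral>\<^sup>+x. h ((f \<circ> g) x) \<partial>lborel)" .
qed

lemma scales_lborel_diagonal:
  fixes c :: "'n::finite \<Rightarrow> real"
  assumes "\<And>i. c i \<noteq> 0"
  shows "scales_lborel (\<lambda>x. \<chi> i. c i * x $ i)"
  unfolding scales_lborel_def
proof
  fix g :: "real^'n \<Rightarrow> ennreal" assume [measurable]: "g \<in> borel_measurable borel"
  define T :: "real^'n \<Rightarrow> real^'n" where "T x = (\<chi> i. c i * x $ i)" for x
  define d where "d b = T b \<bullet> b" for b
  have d: "d (axis i 1) = c i" for i
    by (simp add: d_def T_def inner_axis)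
  have lin: "linear T"
    by (auto simp: T_def linear_iff vec_eq_iff algebra_simps)
  have [measurable]: "T \<in> borel_measurable borel"
    using lin by (rule borel_measurable_linear)
  have T: "0 + (\<Sum>j\<in>Basis. (d j * (x \<bullet> j)) *\<^sub>R j) = T x" for x
  proof -
    have "(\<Sum>j\<in>Basis. (d j * (x \<bullet> j)) *\<^sub>R j) = (\<Sum>i\<in>UNIV. (c i * x $ i) *\<^sub>R axis i 1)"
      by (simp add: Basis_vec_def sum.UNION_disjoint axis_eq_axis d inner_axis)
    also have "\<dots> = T x"
      by (simp add: T_def vec_eq_iff axis_def if_distrib cong: if_cong)
    finally show ?thesis by simp
  qed
  have "(lborel :: (real^'n) measure) = density (distr lborel borel (\<lambda>x. 0 + (\<Sum>j\<in>Basis. (d j * (x \<bullet> j)) *\<^sub>R j)))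
      (\<lambda>_. (\<Prod>j\<in>Basis. \<bar>d j\<bar>))"
    by (rule lborel_affine_euclidean) (auto simp: Basis_vec_def d assms)
  also have "(\<Prod>j\<in>Basis. \<bar>d j\<bar>) = (\<Prod>i\<in>UNIV. \<bar>c i\<bar>)"
    by (simp add: Basis_vec_def prod.UNION_disjoint axis_eq_axis d)
  finally have eq: "lborel = density (distr lborel borel T) (\<lambda>_. ennreal (\<Prod>i\<in>UNIV. \<bar>c i\<bar>))"
    unfolding T .
  have "matrix T = (\<chi> i j. if i = j then c i else 0)"
    by (auto simp: matrix_def T_def vec_eq_iff axis_def)
  then have "det (matrix T) = (\<Prod>i\<in>UNIV. c i)"
    by (subst det_diagonal) auto
  then have "\<bar>det (matrix T)\<bar> = (\<Prod>i\<in>UNIV. \<bar>c i\<bar>)"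
    by (simp add: abs_prod)
  moreover have "(\<integral>\<^sup>+x. g x \<partial>lborel) = ennreal (\<Prod>i\<in>UNIV. \<bar>c i\<bar>) * (\<integral>\<^sup>+x. g (T x) \<partial>lborel)"
    by (subst eq) (simp add: nn_integral_density nn_integral_distr nn_integral_cmult)
  ultimately show "(\<integral>\<^sup>+x. g x \<partial>lborel)
      = ennreal \<bar>det (matrix (\<lambda>x. \<chi> i. c i * x $ i))\<bar> * (\<integral>\<^sup>+x. g (\<chi> i. c i * x $ i) \<partial>lborel)"
    by (simp add: T_def[abs_def])
qed

lemma scales_lborel_swap:
  fixes m n :: "'n::finite"
  assumes "m \<noteq> n"
  shows "scales_lborel (\<lambda>x. \<chi> i. x $ Transposition.transpose m n i)"
proof (rule scales_lborelI_measure_preserving)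
  define p where "p = Transposition.transpose m n"
  define f :: "real^'n \<Rightarrow> real^'n" where "f x = (\<chi> i. x $ p i)" for x
  have pp: "p (p i) = i" for i by (simp add: p_def)
  have p: "p permutes UNIV" by (simp add: p_def permutes_swap_id)
  have lin: "linear f" by (auto simp: f_def linear_iff vec_eq_iff)
  then show "linear (\<lambda>x::real^'n. \<chi> i. x $ Transposition.transpose m n i)"
    by (simp add: f_def[abs_def] p_def)
  have "matrix f = (\<chi> i. mat 1 $ p i)"
    by (auto simp: matrix_def f_def vec_eq_iff axis_def mat_def)
  then have "det (matrix f) = of_int (sign p)"
    using det_permute_rows[OF p, of "mat 1 :: real^'n^'n"] by simp
  then show "\<bar>det (matrix (\<lambda>x::real^'n. \<chi> i. x $ Transposition.transpose m n i))\<bar> = 1"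
    by (simp add: f_def[abs_def] p_def sign_def)
  have [measurable]: "f \<in> borel_measurable borel"
    using lin by (rule borel_measurable_linear)
  have "lborel = distr lborel borel f"
  proof (rule lborel_eqI)
    fix l u :: "real^'n" assume le: "\<And>b. b \<in> Basis \<Longrightarrow> l \<bullet> b \<le> u \<bullet> b"
    have le': "l $ i \<le> u $ i" for i
      using le[of "axis i 1"] by (simp add: inner_axis)
    have prod_Basis: "(\<Prod>b\<in>Basis. (x::real^'n) \<bullet> b) = (\<Prod>i\<in>UNIV. x $ i)" for x
      by (simp add: Basis_vec_def prod.UNION_disjoint axis_eq_axis inner_axis)
    have "f -` box l u = box (f l) (f u)"
      by (auto simp: f_def mem_box_cart) (metis pp)+
    then have "emeasure (distr lborel borel f) (box l u) = (\<Prod>b\<in>Basis. (f u - f l) \<bullet> b)"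
      using le' by (simp add: emeasure_distr emeasure_lborel_box_eq f_def Basis_vec_def inner_axis)
    also have "(\<Prod>b\<in>Basis. (f u - f l) \<bullet> b) = (\<Prod>i\<in>UNIV. (u - l) $ p i)"
      by (simp only: prod_Basis) (simp add: f_def)
    also have "\<dots> = (\<Prod>i\<in>UNIV. (u - l) $ i)"
      using permutes_bij[OF p] by (intro prod.reindex_bij_betw) simp
    finally show "emeasure (distr lborel borel f) (box l u) = (\<Prod>b\<in>Basis. (u - l) \<bullet> b)"
      by (simp only: prod_Basis)
  qed simp
  then show "distr lborel borel (\<lambda>x::real^'n. \<chi> i. x $ Transposition.transpose m n i) = lborel"
    by (simp add: f_def[abs_def] p_def)
qed

text \<open>A shear maps a box to a parallelepiped of the same volume. The volume formula for sheared boxes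
  needs a nonnegative lower corner, so the box is first translated to the origin.\<close>
lemma scales_lborel_shear:
  fixes m n :: "'n::finite"
  assumes "m \<noteq> n"
  shows "scales_lborel (\<lambda>x. \<chi> i. if i = m then x $ m + x $ n else x $ i)"
proof (rule scales_lborelI_measure_preserving)
  define f :: "real^'n \<Rightarrow> real^'n" where "f x = (\<chi> i. if i = m then x $ m + x $ n else x $ i)" for x
  define g :: "real^'n \<Rightarrow> real^'n" where "g x = (\<chi> i. if i = m then x $ m - x $ n else x $ i)" for x
  have lin: "linear f" by (auto simp: f_def linear_iff vec_eq_iff algebra_simps)
  then show "linear (\<lambda>x::real^'n. \<chi> i. if i = m then x $ m + x $ n else x $ i)"
    by (simp add: f_def[abs_def])
  have ling: "linear g" by (auto simp: g_def linear_iff vec_eq_iff algebra_simps)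
  have fg: "f (g x) = x" "g (f x) = x" for x
    using assms by (auto simp: f_def g_def vec_eq_iff)
  have "matrix f = (\<chi> k. if k = m then row m (mat 1) + 1 *s row n (mat 1) else row k (mat 1))"
    by (auto simp: matrix_def f_def vec_eq_iff axis_def mat_def row_def)
  then have "det (matrix f) = 1"
    using det_row_operation[OF assms, of "mat 1 :: real^'n^'n" 1] by simp
  then show "\<bar>det (matrix (\<lambda>x::real^'n. \<chi> i. if i = m then x $ m + x $ n else x $ i))\<bar> = 1"
    by (simp add: f_def[abs_def])
  have [measurable]: "f \<in> borel_measurable borel" "g \<in> borel_measurable borel"
    using lin ling by (auto intro: borel_measurable_linear)
  \<comment> \<open>\<open>g\<close> is the inverse of \<open>f\<close>, so preimages of boxes under \<open>g\<close> are images under \<open>f\<close>.\<close>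
  have inv_f: "lborel = distr lborel borel g"
  proof (rule lborel_eqI)
    fix l u :: "real^'n" assume le: "\<And>b. b \<in> Basis \<Longrightarrow> l \<bullet> b \<le> u \<bullet> b"
    have le': "l $ i \<le> u $ i" for i
      using le[of "axis i 1"] by (simp add: inner_axis)
    have ne: "cbox 0 (u - l) \<noteq> {}"
      using le' by (simp add: interval_ne_empty_cart)
    have "cbox l u = (+) l ` cbox 0 (u - l)"
      using cbox_translation[of l 0 "u - l"] by simp
    then have "f ` cbox l u = (+) (f l) ` (f ` cbox 0 (u - l))"
      by (simp add: image_image linear_add[OF lin])
    then have meas: "measure lebesgue (f ` cbox l u) = measure lebesgue (cbox 0 (u - l))"
      using measure_shear_interval[OF assms ne] by (simp add: measure_translation f_def[abs_def])
    have lmeas: "f ` cbox l u \<in> lmeasurable"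
      using measurable_shear_interval[OF assms ne] \<open>f ` cbox l u = _\<close>
      by (simp add: f_def[abs_def] measurable_translation)
    have "negligible (f ` (cbox l u - box l u))"
      using lin by (intro negligible_differentiable_image_negligible negligible_frontier_interval)
        (auto simp: linear_imp_differentiable_on)
    then have neg: "f ` (cbox l u - box l u) \<in> null_sets lebesgue"
      by (simp add: negligible_iff_null_sets)
    have gf: "g -` A = f ` A" for A
    proof (intro set_eqI iffI)
      fix x assume "x \<in> g -` A"
      then show "x \<in> f ` A" by (intro image_eqI[of _ _ "g x"]) (simp_all add: fg)
    qed (auto simp: fg)
    have [measurable]: "f ` box l u \<in> sets borel"
      unfolding gf[symmetric] using measurable_sets_borel[of g borel "box l u"] by simp
    have "emeasure (distr lborel borel g) (box l u) = emeasure lebesgue (f ` box l u)"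
      by (simp add: emeasure_distr gf)
    also have "\<dots> = emeasure lebesgue (f ` cbox l u)"
    proof -
      have "f ` cbox l u = f ` box l u \<union> f ` (cbox l u - box l u)"
        using box_subset_cbox[of l u] by blast
      then show ?thesis
        using neg by (simp only: emeasure_Un_null_set sets_completionI_sets sets_lborel \<open>f ` box l u \<in> sets borel\<close>)
    qed
    also have "\<dots> = ennreal (measure lebesgue (f ` cbox l u))"
      using lmeas by (simp add: emeasure_eq_measure2)
    also have "\<dots> = ennreal (measure lebesgue (cbox 0 (u - l)))" by (simp add: meas)
    also have "\<dots> = (\<Prod>b\<in>Basis. (u - l) \<bullet> b)"
      using le by (simp add: content_cbox' inner_diff_left measure_completion content_cbox)
    finally show "emeasure (distr lborel borel g) (box l u) = (\<Prod>b\<in>Basis. (u - l) \<bullet> b)" .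
  qed simp
  have "distr lborel borel f = distr (distr lborel borel g) borel f"
    using inv_f by simp
  also have "\<dots> = distr lborel borel (f \<circ> g)"
    by (rule distr_distr) auto
  also have "f \<circ> g = id" using fg by auto
  also have "distr lborel borel id = (lborel :: (real^'n) measure)"
    by (simp add: distr_id2 id_def)
  finally show "distr lborel borel (\<lambda>x::real^'n. \<chi> i. if i = m then x $ m + x $ n else x $ i) = lborel"
    by (simp add: f_def[abs_def])
qed

lemma nn_integral_linear_change_of_variables:
  fixes f :: "real^'n \<Rightarrow> real^'n" and g :: "real^'n \<Rightarrow> ennreal"
  assumes "linear f" and "det (matrix f) \<noteq> 0" and "g \<in> borel_measurable borel"
  shows "(\<integral>\<^sup>+x. g x \<partial>lborel) = ennreal \<bar>det (matrix f)\<bar> * (\<integral>\<^sup>+x. g (f x) \<partial>lborel)"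
proof -
  have "det (matrix f) \<noteq> 0 \<longrightarrow> scales_lborel f"
  proof (rule induct_linear_elementary[OF assms(1)])
    fix f g :: "real^'n \<Rightarrow> real^'n"
    assume "linear f" "linear g" "det (matrix f) \<noteq> 0 \<longrightarrow> scales_lborel f"
      "det (matrix g) \<noteq> 0 \<longrightarrow> scales_lborel g"
    then show "det (matrix (f \<circ> g)) \<noteq> 0 \<longrightarrow> scales_lborel (f \<circ> g)"
      by (auto simp: matrix_compose det_mul intro: scales_lborel_compose)
  next
    fix f :: "real^'n \<Rightarrow> real^'n" and i assume "linear f" and zero: "\<And>x. f x $ i = 0"
    have "row i (matrix f) = 0"
      by (simp add: row_def matrix_def zero vec_eq_iff)
    then show "det (matrix f) \<noteq> 0 \<longrightarrow> scales_lborel f"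
      using det_zero_row by metis
  next
    fix c :: "'n \<Rightarrow> real"
    have "matrix (\<lambda>x::real^'n. \<chi> i. c i * x $ i) = (\<chi> i j. if i = j then c i else 0)"
      by (auto simp: matrix_def vec_eq_iff axis_def)
    then have "det (matrix (\<lambda>x::real^'n. \<chi> i. c i * x $ i)) = (\<Prod>i\<in>UNIV. c i)"
      by (subst det_diagonal) auto
    then show "det (matrix (\<lambda>x::real^'n. \<chi> i. c i * x $ i)) \<noteq> 0
        \<longrightarrow> scales_lborel (\<lambda>x. \<chi> i. c i * x $ i)"
      using scales_lborel_diagonal[of c] by simp
  qed (use scales_lborel_swap scales_lborel_shear in auto)
  then show ?thesis
    using assms(2,3) scales_lborelD by blast
qed


section \<open>Centred Gaussian vectors\<close>

lemma symmetric_matrix_inner: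
  fixes M :: "real^'n^'n"
  assumes "transpose M = M"
  shows "x \<bullet> (M *v y) = y \<bullet> (M *v x)"
  by (metis assms dot_lmul_matrix inner_commute transpose_matrix_vector)

lemma inner_matrix_transpose: "x \<bullet> (M *v y) = (transpose M *v x) \<bullet> (y::real^'n)"
  by (simp add: dot_lmul_matrix transpose_matrix_vector)

text \<open>Gram-Schmidt for the inner product \<open>(x, y) \<mapsto> x \<bullet> (M *v y)\<close>, one index at a time: as long as
  fewer vectors than dimensions are used, some vector lies outside their span.\<close>
lemma pos_def_orthonormal_family:
  fixes M :: "real^'n^'n" and T :: "'n set"
  assumes "sym_pos_def M"
  shows "\<exists>f::'n \<Rightarrow> real^'n. \<forall>i\<in>T. \<forall>j\<in>T. f i \<bullet> (M *v f j) = of_bool (i = j)"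
  using finite[of T]
proof (induction T rule: finite_induct)
  case (insert a T)
  have sym: "x \<bullet> (M *v y) = y \<bullet> (M *v x)" for x y
    using assms by (intro symmetric_matrix_inner) (simp add: sym_pos_def_def)
  obtain f :: "'n \<Rightarrow> real^'n" where f: "\<And>i j. i \<in> T \<Longrightarrow> j \<in> T \<Longrightarrow> f i \<bullet> (M *v f j) = of_bool (i = j)"
    using insert.IH by blast
  have "dim (f ` T) \<le> card T"
    using dim_le_card'[of "f ` T"] card_image_le[of T f] by (simp add: order_trans)
  also have "card T < CARD('n)"
    using insert.hyps by (intro psubset_card_mono) auto
  finally have "span (f ` T) \<noteq> UNIV"
    by (metis dim_UNIV dim_span DIM_cart DIM_real mult.right_neutral less_irrefl)
  then obtain x where x: "x \<notin> span (f ` T)" by blast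
  define y where "y = x - (\<Sum>i\<in>T. (f i \<bullet> (M *v x)) *\<^sub>R f i)"
  have "y \<noteq> 0"
    using x span_sum[of T "\<lambda>i. (f i \<bullet> (M *v x)) *\<^sub>R f i" "f ` T"]
    by (auto simp: y_def span_base span_scale)
  then have q: "0 < y \<bullet> (M *v y)" using assms by (simp add: sym_pos_def_def)
  have orth: "f i \<bullet> (M *v y) = 0" if "i \<in> T" for i
  proof -
    have "f i \<bullet> (M *v y) = f i \<bullet> (M *v x) - (\<Sum>j\<in>T. (f j \<bullet> (M *v x)) * (f i \<bullet> (M *v f j)))"
      by (simp add: y_def matrix_vector_mult_diff_distrib linear_sum[OF matrix_vector_mul_linear]
          inner_diff_right inner_sum_right matrix_vector_mult_scaleR)
    also have "(\<Sum>j\<in>T. (f j \<bullet> (M *v x)) * (f i \<bullet> (M *v f j))) = (\<Sum>j\<in>T. if j = i then f i \<bullet> (M *v x) else 0)"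
      using that by (intro sum.cong) (auto simp: f)
    finally show ?thesis using that insert.hyps by simp
  qed
  have orth': "y \<bullet> (M *v f i) = 0" if "i \<in> T" for i
    using orth[OF that] sym[of y "f i"] by simp
  define g where "g = f(a := (1 / sqrt (y \<bullet> (M *v y))) *\<^sub>R y)"
  have "g i \<bullet> (M *v g j) = of_bool (i = j)" if "i \<in> insert a T" "j \<in> insert a T" for i j
    using that insert.hyps q f orth orth'
    by (auto simp: g_def matrix_vector_mult_scaleR)
  then show ?case by blast
qed simp

text \<open>With \<open>C\<close> having \<open>D\<close>-orthonormal columns, \<open>C\<^sup>T D C = 1\<close>. So \<open>C\<^sup>T\<close> turns the quadratic form of the
  inverse of \<open>D\<close> into the squared norm, which normalises the Gaussian density without a spectral
  theorem.\<close>
lemma pos_def_inverse_factorization: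
  fixes D :: "real^'n^'n"
  assumes "sym_pos_def D"
  obtains C where "matrix_inv D = C ** transpose C" "matrix_inv D ** D = mat 1" "(det C)\<^sup>2 * det D = 1"
proof -
  obtain f :: "'n \<Rightarrow> real^'n" where f: "\<And>i j. f i \<bullet> (D *v f j) = of_bool (i = j)"
    using pos_def_orthonormal_family[OF assms, of UNIV] by auto
  define C :: "real^'n^'n" where "C = (\<chi> r i. f i $ r)"
  have entry: "(transpose C ** (D ** C)) $ i $ j = f i \<bullet> (D *v f j)" for i j
    by (simp add: matrix_matrix_mult_def matrix_vector_mult_def transpose_def C_def inner_vec_def)
  have CDC: "transpose C ** (D ** C) = mat 1"
    by (simp add: vec_eq_iff entry f mat_def)
  then have "(transpose C ** D) ** C = mat 1"
    by (simp add: matrix_mul_assoc)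
  then have "C ** (transpose C ** D) = mat 1"
    using matrix_left_right_inverse by blast
  then have left: "(C ** transpose C) ** D = mat 1"
    by (simp add: matrix_mul_assoc)
  then have right: "D ** (C ** transpose C) = mat 1"
    using matrix_left_right_inverse by blast
  have inv: "matrix_inv D = C ** transpose C"
  proof -
    have "D ** matrix_inv D = mat 1"
      unfolding matrix_inv_def
      by (rule someI2[where a="C ** transpose C"]) (use left right in auto)
    then have "(C ** transpose C) ** (D ** matrix_inv D) = C ** transpose C" by simp
    then show ?thesis by (simp add: matrix_mul_assoc left)
  qed
  have "det (transpose C ** (D ** C)) = 1"
    by (simp add: CDC)
  then have "(det C)\<^sup>2 * det D = 1"
    by (simp add: det_mul power2_eq_square mult_ac)
  with inv left show ?thesis by (intro that) auto
qed

lemma nn_integral_std_gaussian: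
  "(\<integral>\<^sup>+x. ennreal (exp (- (x \<bullet> x) / 2)) \<partial>(lborel :: (real^'n) measure)) = ennreal (sqrt ((2 * pi) ^ CARD('n)))"
proof -
  have one: "(\<integral>\<^sup>+x. ennreal (exp (- x\<^sup>2 / 2)) \<partial>lborel) = ennreal (sqrt (2 * pi))"
  proof -
    have "(\<integral>\<^sup>+x. ennreal (exp (- x\<^sup>2 / 2)) \<partial>lborel)
        = (\<integral>\<^sup>+x. ennreal (sqrt (2 * pi)) * ennreal (std_normal_density x) \<partial>lborel)"
      by (intro nn_integral_cong) (simp add: normal_density_def flip: ennreal_mult)
    also have "\<dots> = ennreal (sqrt (2 * pi)) * (\<integral>\<^sup>+x. ennreal (std_normal_density x) \<partial>lborel)"
      by (rule nn_integral_cmult) simp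
    also have "(\<integral>\<^sup>+x. ennreal (std_normal_density x) \<partial>lborel) = 1"
      by (subst nn_integral_eq_integral) auto
    finally show ?thesis by simp
  qed
  have "(\<integral>\<^sup>+x. ennreal (exp (- (x \<bullet> x) / 2)) \<partial>(lborel :: (real^'n) measure))
      = (\<integral>\<^sup>+x. (\<Prod>b\<in>Basis. ennreal (exp (- (x \<bullet> b)\<^sup>2 / 2))) \<partial>(lborel :: (real^'n) measure))"
  proof (intro nn_integral_cong)
    fix x :: "real^'n"
    have "- (x \<bullet> x) / 2 = (\<Sum>b\<in>Basis. - (x \<bullet> b)\<^sup>2 / 2)"
      by (subst euclidean_inner) (simp add: power2_eq_square sum_negf sum_divide_distrib)
    then show "ennreal (exp (- (x \<bullet> x) / 2)) = (\<Prod>b\<in>Basis. ennreal (exp (- (x \<bullet> b)\<^sup>2 / 2)))"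
      by (simp add: exp_sum prod_ennreal)
  qed
  also have "\<dots> = (\<Prod>b\<in>(Basis::(real^'n) set). \<integral>\<^sup>+x. ennreal (exp (- x\<^sup>2 / 2)) \<partial>lborel)"
    by (rule nn_integral_lborel_prod) auto
  also have "\<dots> = ennreal (sqrt ((2 * pi) ^ CARD('n)))"
    by (simp only: one prod_constant ennreal_power real_sqrt_power[symmetric] DIM_cart DIM_real
        real_sqrt_ge_0_iff mult_1_right) (simp add: ennreal_power flip: real_sqrt_power)
  finally show ?thesis .
qed

text \<open>Centred Gaussian laws are characterised by their moment generating function rather than by a
  density: this property passes to linear images and independent sums by Tonelli alone, and \<open>D\<close> may
  be singular.\<close>
definition gaussian_vector :: "'a measure \<Rightarrow> ('a \<Rightarrow> real^'n) \<Rightarrow> real^'n^'n \<Rightarrow> bool" where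
  "gaussian_vector M X D \<longleftrightarrow> prob_space M \<and> X \<in> borel_measurable M \<and>
     transpose D = D \<and> (\<forall>v. (\<integral>\<^sup>+\<omega>. ennreal (exp (v \<bullet> X \<omega>)) \<partial>M) = ennreal (exp (v \<bullet> (D *v v) / 2)))"

lemma borel_measurable_matrix_vector [measurable]:
  fixes A :: "real^'n^'m"
  shows "(\<lambda>x. A *v x) \<in> borel_measurable borel"
  by (rule borel_measurable_linear) simp

text \<open>Completing the square reduces the moment generating function to the total mass by a translation
  by \<open>D v\<close>; the total mass is a linear change of variables away from the standard Gaussian integral.\<close>
lemma gaussian_vector_gaussian:
  fixes D :: "real^'n^'n"
  assumes "sym_pos_def D"
  shows "gaussian_vector (gaussian D) (\<lambda>x. x) D"
proof -
  obtain C where C: "matrix_inv D = C ** transpose C" "matrix_inv D ** D = mat 1" "(det C)\<^sup>2 * det D = 1"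
    using pos_def_inverse_factorization[OF assms] by blast
  define M where "M = matrix_inv D"
  define c where "c = sqrt ((2 * pi) ^ CARD('n) * det D)"
  have detC: "det C \<noteq> 0" using C(3) by auto
  have detD: "det D = 1 / (det C)\<^sup>2" using C(3) detC by (simp add: field_simps)
  then have c: "c = sqrt ((2 * pi) ^ CARD('n)) / \<bar>det C\<bar>"
    by (simp add: c_def real_sqrt_mult real_sqrt_divide)
  have c_pos: "c > 0" using detC by (simp add: c)
  have MD: "M *v (D *v x) = x" for x
    by (simp add: M_def matrix_vector_mul_assoc C(2))
  have symM: "transpose M = M"
    by (simp add: M_def C(1) matrix_transpose_mul)
  have mass: "(\<integral>\<^sup>+x. ennreal (exp (- (x \<bullet> (M *v x)) / 2)) \<partial>lborel) = ennreal c"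
  proof -
    have sq: "x \<bullet> (M *v x) = (transpose C *v x) \<bullet> (transpose C *v x)" for x
      by (simp add: M_def C(1) inner_matrix_transpose flip: matrix_vector_mul_assoc)
    have "ennreal (sqrt ((2 * pi) ^ CARD('n)))
        = ennreal \<bar>det (matrix ((*v) (transpose C)))\<bar> *
          (\<integral>\<^sup>+x. ennreal (exp (- ((transpose C *v x) \<bullet> (transpose C *v x)) / 2)) \<partial>lborel)"
      unfolding nn_integral_std_gaussian[symmetric]
      by (rule nn_integral_linear_change_of_variables) (auto simp: detC)
    also have "\<dots> = ennreal \<bar>det C\<bar> * (\<integral>\<^sup>+x. ennreal (exp (- (x \<bullet> (M *v x)) / 2)) \<partial>lborel)"
      by (simp add: sq)
    finally have "ennreal (1 / \<bar>det C\<bar>) * ennreal (sqrt ((2 * pi) ^ CARD('n)))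
        = (ennreal (1 / \<bar>det C\<bar>) * ennreal \<bar>det C\<bar>) * (\<integral>\<^sup>+x. ennreal (exp (- (x \<bullet> (M *v x)) / 2)) \<partial>lborel)"
      by (simp add: mult.assoc)
    then show ?thesis
      using detC by (simp add: c flip: ennreal_mult)
  qed
  have mgf: "(\<integral>\<^sup>+x. ennreal (exp (v \<bullet> x)) \<partial>gaussian D) = ennreal (exp (v \<bullet> (D *v v) / 2))" for v
  proof -
    define k where "k x = ennreal (exp (v \<bullet> x - x \<bullet> (M *v x) / 2))" for x
    have [measurable]: "k \<in> borel_measurable borel"
      unfolding k_def by measurable
    have "(\<integral>\<^sup>+x. ennreal (exp (v \<bullet> x)) \<partial>gaussian D) = (\<integral>\<^sup>+x. ennreal (1 / c) * k x \<partial>lborel)"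
    proof -
      have "ennreal (exp (- (x \<bullet> (M *v x)) / 2) / c) * ennreal (exp (v \<bullet> x)) = ennreal (1 / c) * k x" for x
      proof -
        have "exp (- (x \<bullet> (M *v x)) / 2) / c * exp (v \<bullet> x) = 1 / c * exp (v \<bullet> x - x \<bullet> (M *v x) / 2)"
          by (simp add: mult_exp_exp)
        then show ?thesis
          using c_pos by (simp add: k_def flip: ennreal_mult)
      qed
      then show ?thesis
        unfolding gaussian_def c_def[symmetric] M_def[symmetric]
        by (subst nn_integral_density) auto
    qed
    also have "\<dots> = ennreal (1 / c) * (\<integral>\<^sup>+x. k x \<partial>lborel)"
      by (rule nn_integral_cmult) measurable
    also have "(\<integral>\<^sup>+x. k x \<partial>lborel) = (\<integral>\<^sup>+x. k x \<partial>distr lborel borel ((+) (D *v v)))"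
      by (simp add: lborel_distr_plus)
    also have "\<dots> = (\<integral>\<^sup>+x. k (D *v v + x) \<partial>lborel)"
      by (rule nn_integral_distr) auto
    also have "\<dots> = (\<integral>\<^sup>+x. ennreal (exp (v \<bullet> (D *v v) / 2)) * ennreal (exp (- (x \<bullet> (M *v x)) / 2)) \<partial>lborel)"
    proof (intro nn_integral_cong)
      fix x :: "real^'n"
      have "v \<bullet> (D *v v + x) - (D *v v + x) \<bullet> (M *v (D *v v + x)) / 2
          = v \<bullet> (D *v v) / 2 + - (x \<bullet> (M *v x)) / 2"
        using symmetric_matrix_inner[OF symM, of "D *v v" x]
        by (simp add: matrix_vector_right_distrib inner_add_right inner_add_left MD
            inner_commute[of _ v] field_simps)
      then show "k (D *v v + x)
          = ennreal (exp (v \<bullet> (D *v v) / 2)) * ennreal (exp (- (x \<bullet> (M *v x)) / 2))"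
        unfolding k_def by (simp only: exp_add flip: ennreal_mult) (simp flip: ennreal_mult)
    qed
    also have "\<dots> = ennreal (exp (v \<bullet> (D *v v) / 2)) *
        (\<integral>\<^sup>+x. ennreal (exp (- (x \<bullet> (M *v x)) / 2)) \<partial>lborel)"
      by (rule nn_integral_cmult) measurable
    also have "(\<integral>\<^sup>+x. ennreal (exp (- (x \<bullet> (M *v x)) / 2)) \<partial>lborel) = ennreal c"
      by (rule mass)
    finally show ?thesis
      using c_pos by (simp flip: ennreal_mult)
  qed
  have "emeasure (gaussian D) (space (gaussian D)) = 1"
    using mgf[of 0] by simp
  then show ?thesis
    using mgf assms
    by (auto simp: gaussian_vector_def gaussian_def sym_pos_def_def intro!: prob_spaceI)
qed

text \<open>Independence is the product measure, so the generating function of the sum factors.\<close>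
lemma gaussian_vector_affine_pair:
  fixes X :: "'a \<Rightarrow> real^'n" and Y :: "'b \<Rightarrow> real^'m" and F :: "real^'n^'k" and G :: "real^'m^'k"
  assumes X: "gaussian_vector M X D" and Y: "gaussian_vector N Y E"
  shows "gaussian_vector (M \<Otimes>\<^sub>M N) (\<lambda>(\<omega>, \<zeta>). F *v X \<omega> + G *v Y \<zeta>)
           (F ** D ** transpose F + G ** E ** transpose G)"
proof -
  interpret M: prob_space M using X by (simp add: gaussian_vector_def)
  interpret N: prob_space N using Y by (simp add: gaussian_vector_def)
  interpret pair_prob_space M N ..
  have [measurable]: "X \<in> borel_measurable M" "Y \<in> borel_measurable N"
    using X Y by (auto simp: gaussian_vector_def)
  have "(\<integral>\<^sup>+p. ennreal (exp (v \<bullet> (case p of (\<omega>, \<zeta>) \<Rightarrow> F *v X \<omega> + G *v Y \<zeta>))) \<partial>(M \<Otimes>\<^sub>M N))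
      = ennreal (exp (v \<bullet> ((F ** D ** transpose F + G ** E ** transpose G) *v v) / 2))" for v
  proof -
    let ?a = "transpose F *v v" and ?b = "transpose G *v v"
    have "(\<integral>\<^sup>+p. ennreal (exp (v \<bullet> (case p of (\<omega>, \<zeta>) \<Rightarrow> F *v X \<omega> + G *v Y \<zeta>))) \<partial>(M \<Otimes>\<^sub>M N))
        = (\<integral>\<^sup>+\<omega>. (\<integral>\<^sup>+\<zeta>. ennreal (exp (?a \<bullet> X \<omega>)) * ennreal (exp (?b \<bullet> Y \<zeta>)) \<partial>N) \<partial>M)"
      by (subst N.nn_integral_fst[symmetric])
         (auto simp: inner_add_right exp_add inner_matrix_transpose ennreal_mult)
    also have "\<dots> = (\<integral>\<^sup>+\<omega>. ennreal (exp (?a \<bullet> X \<omega>)) * ennreal (exp (?b \<bullet> (E *v ?b) / 2)) \<partial>M)"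
      using Y by (subst nn_integral_cmult) (auto simp: gaussian_vector_def)
    also have "\<dots> = ennreal (exp (?a \<bullet> (D *v ?a) / 2)) * ennreal (exp (?b \<bullet> (E *v ?b) / 2))"
      using X by (subst nn_integral_multc) (auto simp: gaussian_vector_def)
    also have "\<dots> = ennreal (exp (v \<bullet> ((F ** D ** transpose F + G ** E ** transpose G) *v v) / 2))"
      by (simp add: matrix_vector_mult_add_rdistrib inner_add_right inner_matrix_transpose[of v F]
          inner_matrix_transpose[of v G] add_divide_distrib exp_add ennreal_mult
          flip: matrix_vector_mul_assoc)
    finally show ?thesis .
  qed
  moreover have "transpose (F ** D ** transpose F + G ** E ** transpose G)
      = F ** D ** transpose F + G ** E ** transpose G"
  proof -
    have add: "transpose (P + Q) = transpose P + transpose Q" for P Q :: "real^'k^'k"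
      by (simp add: transpose_def vec_eq_iff)
    have "transpose D = D" "transpose E = E"
      using X Y by (auto simp: gaussian_vector_def)
    then show ?thesis
      by (simp add: add matrix_transpose_mul matrix_mul_assoc)
  qed
  ultimately show ?thesis
    by (auto simp: gaussian_vector_def prob_space_axioms)
qed


section \<open>Moments of centred Gaussian vectors\<close>

text \<open>The constant coefficient is the limit at 0; then divide by \<open>t\<close> and repeat.\<close>
lemma powser_zero_imp_coeff_zero:
  fixes a :: "nat \<Rightarrow> real"
  assumes "\<And>t. (\<lambda>n. a n * t ^ n) sums 0"
  shows "a k = 0"
  using assms
proof (induction k arbitrary: a)
  case 0
  have "((\<lambda>_. 0) \<longlongrightarrow> a 0) (at (0::real))"
    using 0 by (intro powser_limit_0_strong[of 1]) auto
  then show ?case by (simp add: tendsto_const_iff)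
next
  case (Suc k)
  have "((\<lambda>_. 0) \<longlongrightarrow> a 0) (at (0::real))"
    using Suc.prems by (intro powser_limit_0_strong[of 1]) auto
  then have a0: "a 0 = 0" by (simp add: tendsto_const_iff)
  define b where "b n = a (Suc n)" for n
  have b: "(\<lambda>n. b n * t ^ n) sums 0" if "t \<noteq> 0" for t
  proof -
    have "(\<lambda>n. a (Suc n) * t ^ Suc n) sums 0"
      using Suc.prems[of t] a0 by (subst sums_Suc_iff) simp
    then have "(\<lambda>n. a (Suc n) * t ^ Suc n * (1 / t)) sums (0 * (1 / t))"
      by (rule sums_mult2)
    then show ?thesis using that by (simp add: b_def)
  qed
  have "((\<lambda>_. 0) \<longlongrightarrow> b 0) (at (0::real))"
    using b by (intro powser_limit_0_strong[of 1]) auto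
  then have "b 0 = 0" by (simp add: tendsto_const_iff)
  then have "(\<lambda>n. b n * t ^ n) sums 0" for t
    using b[of t] powser_sums_zero[of b] by (cases "t = 0") auto
  then show ?case using Suc.IH[of b] by (simp add: b_def)
qed

text \<open>Since \<open>exp |t Y|\<close> is integrable, the expectation of \<open>exp (t Y)\<close> is the power series with the
  coefficients \<open>E[Y\<^sup>n] / n!\<close>. Comparing it with the series of \<open>exp (t\<^sup>2 q / 2)\<close> gives all moments.\<close>
lemma gaussian_mgf_moments:
  fixes Y :: "'a \<Rightarrow> real"
  assumes "prob_space M" and Y [measurable]: "Y \<in> borel_measurable M"
    and mgf: "\<And>t. (\<integral>\<^sup>+\<omega>. ennreal (exp (t * Y \<omega>)) \<partial>M) = ennreal (exp (t\<^sup>2 * q / 2))"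
  shows "has_bochner_integral M Y 0"
    and "has_bochner_integral M (\<lambda>\<omega>. (Y \<omega>)\<^sup>2) q"
    and "has_bochner_integral M (\<lambda>\<omega>. (Y \<omega>) ^ 4) (3 * q\<^sup>2)"
proof -
  have exp_int: "has_bochner_integral M (\<lambda>\<omega>. exp (t * Y \<omega>)) (exp (t\<^sup>2 * q / 2))" for t
    using mgf[of t] by (intro has_bochner_integral_nn_integral) auto
  have abs_int: "integrable M (\<lambda>\<omega>. exp \<bar>t * Y \<omega>\<bar>)" for t
  proof (rule Bochner_Integration.integrable_bound)
    show "integrable M (\<lambda>\<omega>. exp (t * Y \<omega>) + exp (- t * Y \<omega>))"
      using exp_int[of t] exp_int[of "-t"]
      by (intro Bochner_Integration.integrable_add) (auto simp: has_bochner_integral_iff)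
    show "AE \<omega> in M. norm (exp \<bar>t * Y \<omega>\<bar>) \<le> norm (exp (t * Y \<omega>) + exp (- t * Y \<omega>))"
    proof (intro AE_I2)
      fix \<omega>
      have "exp \<bar>t * Y \<omega>\<bar> \<le> exp (t * Y \<omega>) + exp (- t * Y \<omega>)"
        by (cases "t * Y \<omega> < 0") (simp_all add: abs_if)
      also have "\<dots> \<le> norm (exp (t * Y \<omega>) + exp (- t * Y \<omega>))"
        unfolding real_norm_def by (rule abs_ge_self)
      finally show "norm (exp \<bar>t * Y \<omega>\<bar>) \<le> norm (exp (t * Y \<omega>) + exp (- t * Y \<omega>))"
        by simp
    qed
  qed measurable
  have partial_le: "(\<Sum>k<n. \<bar>y\<bar> ^ k / fact k) \<le> exp \<bar>y\<bar>" for n and y :: real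
  proof -
    have "(\<Sum>k<n. \<bar>y\<bar> ^ k / fact k) \<le> (\<Sum>k. \<bar>y\<bar> ^ k / fact k)"
    proof (rule sum_le_suminf)
      show "summable (\<lambda>k. \<bar>y\<bar> ^ k / fact k)"
        using summable_exp[of "\<bar>y\<bar>"] by (simp add: divide_inverse mult.commute)
    qed auto
    then show ?thesis by (simp add: exp_def divide_inverse mult.commute)
  qed
  have term_le: "\<bar>y\<bar> ^ n / fact n \<le> exp \<bar>y\<bar>" for n and y :: real
  proof -
    have "\<bar>y\<bar> ^ n / fact n \<le> (\<Sum>k<Suc n. \<bar>y\<bar> ^ k / fact k)"
      by (simp add: sum_nonneg)
    then show ?thesis using partial_le[where n="Suc n"] order_trans by blast
  qed
  have term_int: "integrable M (\<lambda>\<omega>. (t * Y \<omega>) ^ n / fact n)" for t n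
  proof (rule Bochner_Integration.integrable_bound[OF abs_int[of t]])
    show "AE \<omega> in M. norm ((t * Y \<omega>) ^ n / fact n) \<le> norm (exp \<bar>t * Y \<omega>\<bar>)"
      using term_le by (intro AE_I2) (simp add: power_abs)
  qed measurable
  have pow_int: "integrable M (\<lambda>\<omega>. (Y \<omega>) ^ n)" for n
    using integrable_mult_right[OF term_int[of 1 n], of "fact n"] by simp
  define m where "m n = (\<integral>\<omega>. (Y \<omega>) ^ n \<partial>M)" for n
  have series: "(\<lambda>n. m n / fact n * t ^ n) sums exp (t\<^sup>2 * q / 2)" for t
  proof -
    have "(\<lambda>n. \<integral>\<omega>. (t * Y \<omega>) ^ n / fact n \<partial>M) sums (\<integral>\<omega>. (\<Sum>n. (t * Y \<omega>) ^ n / fact n) \<partial>M)"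
    proof (rule sums_integral)
      show "AE \<omega> in M. summable (\<lambda>n. norm ((t * Y \<omega>) ^ n / fact n))"
      proof (intro AE_I2)
        fix \<omega>
        show "summable (\<lambda>n. norm ((t * Y \<omega>) ^ n / fact n))"
          using summable_norm_exp[of "t * Y \<omega>"] by (simp add: divide_inverse mult.commute)
      qed
      show "summable (\<lambda>n. \<integral>\<omega>. norm ((t * Y \<omega>) ^ n / fact n) \<partial>M)"
      proof (rule summableI_nonneg_bounded)
        fix n
        have "(\<Sum>k<n. \<integral>\<omega>. norm ((t * Y \<omega>) ^ k / fact k) \<partial>M)
            = (\<integral>\<omega>. (\<Sum>k<n. norm ((t * Y \<omega>) ^ k / fact k)) \<partial>M)"
          by (intro Bochner_Integration.integral_sum[symmetric] integrable_norm term_int)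
        also have "\<dots> \<le> (\<integral>\<omega>. exp \<bar>t * Y \<omega>\<bar> \<partial>M)"
          using partial_le
          by (intro integral_mono Bochner_Integration.integrable_sum integrable_norm term_int abs_int)
             (simp add: power_abs)
        finally show "(\<Sum>k<n. \<integral>\<omega>. norm ((t * Y \<omega>) ^ k / fact k) \<partial>M) \<le> (\<integral>\<omega>. exp \<bar>t * Y \<omega>\<bar> \<partial>M)" .
      qed simp
    qed (rule term_int)
    moreover have "(\<integral>\<omega>. (t * Y \<omega>) ^ n / fact n \<partial>M) = m n / fact n * t ^ n" for n
      by (simp add: m_def power_mult_distrib)
    moreover have "(\<Sum>n. (t * Y \<omega>) ^ n / fact n) = exp (t * Y \<omega>)" for \<omega>
      by (simp add: exp_def divide_inverse mult.commute)
    ultimately show ?thesis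
      using exp_int[of t] by (simp add: has_bochner_integral_iff)
  qed
  define c where "c n = (if even n then (q / 2) ^ (n div 2) / fact (n div 2) else 0)" for n
  have gauss_series: "(\<lambda>n. c n * t ^ n) sums exp (t\<^sup>2 * q / 2)" for t
  proof -
    have "(\<lambda>n. c (2 * n) * t ^ (2 * n)) sums exp (t\<^sup>2 * q / 2)"
    proof -
      have "(\<lambda>n. (t\<^sup>2 * q / 2) ^ n /\<^sub>R fact n) sums exp (t\<^sup>2 * q / 2)"
        by (rule exp_converges)
      moreover have "c (2 * n) * t ^ (2 * n) = (t\<^sup>2 * q / 2) ^ n /\<^sub>R fact n" for n
      proof -
        have "c (2 * n) * t ^ (2 * n) = (q / 2) ^ n * (t\<^sup>2) ^ n / fact n"
          by (simp add: c_def power_mult)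
        also have "\<dots> = (q / 2 * t\<^sup>2) ^ n / fact n"
          by (simp only: power_mult_distrib)
        also have "q / 2 * t\<^sup>2 = t\<^sup>2 * q / 2" by simp
        finally have "c (2 * n) * t ^ (2 * n) = (t\<^sup>2 * q / 2) ^ n / fact n" .
        also have "\<dots> = (t\<^sup>2 * q / 2) ^ n /\<^sub>R fact n"
          by (simp only: divide_inverse real_scaleR_def mult.commute)
        finally show ?thesis .
      qed
      ultimately show ?thesis by simp
    qed
    moreover have "strict_mono (\<lambda>n::nat. 2 * n)"
      by (simp add: strict_mono_def)
    moreover have "c n * t ^ n = 0" if "n \<notin> range (\<lambda>n. 2 * n)" for n
      using that by (auto simp: c_def elim!: evenE)
    ultimately show ?thesis
      using sums_mono_reindex[of "\<lambda>n. 2 * n" "\<lambda>n. c n * t ^ n" "exp (t\<^sup>2 * q / 2)"] by blast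
  qed
  have "m k / fact k - c k = 0" for k
  proof (rule powser_zero_imp_coeff_zero)
    fix t
    show "(\<lambda>n. (m n / fact n - c n) * t ^ n) sums 0"
      using sums_diff[OF series[of t] gauss_series[of t]] by (simp add: left_diff_distrib)
  qed
  then have m: "m k = c k * fact k" for k
    by (simp add: field_simps)
  show "has_bochner_integral M Y 0"
    using m[of 1] pow_int[of 1] by (simp add: m_def c_def has_bochner_integral_iff)
  show "has_bochner_integral M (\<lambda>\<omega>. (Y \<omega>)\<^sup>2) q"
    using m[of 2] pow_int[of 2] by (simp add: m_def c_def has_bochner_integral_iff)
  have "c 4 * fact 4 = 3 * q\<^sup>2"
    by (simp add: c_def fact_numeral power2_eq_square)
  then show "has_bochner_integral M (\<lambda>\<omega>. (Y \<omega>) ^ 4) (3 * q\<^sup>2)"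
    using m[of 4] pow_int[of 4] by (simp add: m_def has_bochner_integral_iff)
qed

lemma gaussian_vector_linear_form:
  assumes "gaussian_vector M X D"
  shows "has_bochner_integral M (\<lambda>\<omega>. v \<bullet> X \<omega>) 0"
    and "has_bochner_integral M (\<lambda>\<omega>. (v \<bullet> X \<omega>)\<^sup>2) (v \<bullet> (D *v v))"
    and "has_bochner_integral M (\<lambda>\<omega>. (v \<bullet> X \<omega>) ^ 4) (3 * (v \<bullet> (D *v v))\<^sup>2)"
proof -
  have [measurable]: "X \<in> borel_measurable M" and "prob_space M"
    using assms by (auto simp: gaussian_vector_def)
  have mgf: "(\<integral>\<^sup>+\<omega>. ennreal (exp (t * (v \<bullet> X \<omega>))) \<partial>M) = ennreal (exp (t\<^sup>2 * (v \<bullet> (D *v v)) / 2))" for t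
  proof -
    have "(\<integral>\<^sup>+\<omega>. ennreal (exp ((t *\<^sub>R v) \<bullet> X \<omega>)) \<partial>M)
        = ennreal (exp ((t *\<^sub>R v) \<bullet> (D *v (t *\<^sub>R v)) / 2))"
      using assms unfolding gaussian_vector_def by blast
    then show ?thesis by (simp add: matrix_vector_mult_scaleR power2_eq_square mult.assoc)
  qed
  note moments = gaussian_mgf_moments[OF \<open>prob_space M\<close> _ mgf]
  show "has_bochner_integral M (\<lambda>\<omega>. v \<bullet> X \<omega>) 0"
    and "has_bochner_integral M (\<lambda>\<omega>. (v \<bullet> X \<omega>)\<^sup>2) (v \<bullet> (D *v v))"
    and "has_bochner_integral M (\<lambda>\<omega>. (v \<bullet> X \<omega>) ^ 4) (3 * (v \<bullet> (D *v v))\<^sup>2)"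
    by (rule moments, measurable)+
qed

lemma gaussian_vector_second_moment:
  assumes "gaussian_vector M X D"
  shows "has_bochner_integral M (\<lambda>\<omega>. (p \<bullet> X \<omega>) * (q \<bullet> X \<omega>)) (p \<bullet> (D *v q))"
proof -
  have sym: "q \<bullet> (D *v p) = p \<bullet> (D *v q)"
    using assms by (intro symmetric_matrix_inner) (simp add: gaussian_vector_def)
  note sq = gaussian_vector_linear_form(2)[OF assms]
  have "has_bochner_integral M (\<lambda>\<omega>. (((p + q) \<bullet> X \<omega>)\<^sup>2 - ((p - q) \<bullet> X \<omega>)\<^sup>2) / 4)
      (((p + q) \<bullet> (D *v (p + q)) - (p - q) \<bullet> (D *v (p - q))) / 4)"
    by (intro has_bochner_integral_divide_zero has_bochner_integral_diff sq)
  then show ?thesis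
    by (rule back_subst[where P="\<lambda>x. x"], intro arg_cong2[where f="has_bochner_integral M"])
       (auto simp: fun_eq_iff inner_add_left inner_diff_left inner_add_right inner_diff_right
          matrix_vector_right_distrib matrix_vector_mult_diff_distrib sym power2_eq_square field_simps)
qed

text \<open>Isserlis' formula. Only fourth powers of linear forms are known at first; polarisation gives
  first the products \<open>x\<^sup>2 y\<^sup>2\<close>, then \<open>x y z\<^sup>2\<close>, and finally four arbitrary factors.\<close>
lemma gaussian_vector_fourth_moment:
  assumes "gaussian_vector M X D"
  shows "has_bochner_integral M (\<lambda>\<omega>. (p \<bullet> X \<omega>) * (q \<bullet> X \<omega>) * (r \<bullet> X \<omega>) * (s \<bullet> X \<omega>))
    ((p \<bullet> (D *v q)) * (r \<bullet> (D *v s)) + (p \<bullet> (D *v r)) * (q \<bullet> (D *v s)) + (p \<bullet> (D *v s)) * (q \<bullet> (D *v r)))"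
proof -
  define B where "B x y = x \<bullet> (D *v y)" for x y
  have sym: "B x y = B y x" for x y
    unfolding B_def using assms by (intro symmetric_matrix_inner) (simp add: gaussian_vector_def)
  have add: "B (x + y) z = B x z + B y z" "B x (y + z) = B x y + B x z"
    and diff: "B (x - y) z = B x z - B y z" "B x (y - z) = B x y - B x z" for x y z
    by (simp_all add: B_def inner_add_left inner_diff_left inner_add_right inner_diff_right
          matrix_vector_right_distrib matrix_vector_mult_diff_distrib)
  have four: "has_bochner_integral M (\<lambda>\<omega>. (v \<bullet> X \<omega>) ^ 4) (3 * (B v v)\<^sup>2)" for v
    unfolding B_def by (rule gaussian_vector_linear_form(3)[OF assms])
  have squares: "has_bochner_integral M (\<lambda>\<omega>. (x \<bullet> X \<omega>)\<^sup>2 * (y \<bullet> X \<omega>)\<^sup>2) (B x x * B y y + 2 * (B x y)\<^sup>2)" for x y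
  proof -
    have "has_bochner_integral M (\<lambda>\<omega>. (((x + y) \<bullet> X \<omega>) ^ 4 + ((x - y) \<bullet> X \<omega>) ^ 4
          - (2 * (x \<bullet> X \<omega>) ^ 4 + 2 * (y \<bullet> X \<omega>) ^ 4)) / 12)
        ((3 * (B (x + y) (x + y))\<^sup>2 + 3 * (B (x - y) (x - y))\<^sup>2
          - (2 * (3 * (B x x)\<^sup>2) + 2 * (3 * (B y y)\<^sup>2))) / 12)"
      by (intro has_bochner_integral_divide_zero has_bochner_integral_diff has_bochner_integral_add
          has_bochner_integral_mult_right four)
    moreover have "(((x + y) \<bullet> w) ^ 4 + ((x - y) \<bullet> w) ^ 4 - (2 * (x \<bullet> w) ^ 4 + 2 * (y \<bullet> w) ^ 4)) / 12
        = (x \<bullet> w)\<^sup>2 * (y \<bullet> w)\<^sup>2" for w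
      by (simp add: inner_add_left inner_diff_left power4_eq_xxxx power2_eq_square) algebra
    moreover have "(3 * (B (x + y) (x + y))\<^sup>2 + 3 * (B (x - y) (x - y))\<^sup>2
          - (2 * (3 * (B x x)\<^sup>2) + 2 * (3 * (B y y)\<^sup>2))) / 12 = B x x * B y y + 2 * (B x y)\<^sup>2"
      by (simp add: add diff sym[of y x] power2_eq_square) algebra
    ultimately show ?thesis by (simp only:)
  qed
  have mixed: "has_bochner_integral M (\<lambda>\<omega>. (x \<bullet> X \<omega>) * (y \<bullet> X \<omega>) * (z \<bullet> X \<omega>)\<^sup>2)
      (B x y * B z z + 2 * (B x z * B y z))" for x y z
  proof -
    have "has_bochner_integral M (\<lambda>\<omega>. (((x + y) \<bullet> X \<omega>)\<^sup>2 * (z \<bullet> X \<omega>)\<^sup>2 - ((x - y) \<bullet> X \<omega>)\<^sup>2 * (z \<bullet> X \<omega>)\<^sup>2) / 4)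
        (((B (x + y) (x + y) * B z z + 2 * (B (x + y) z)\<^sup>2)
          - (B (x - y) (x - y) * B z z + 2 * (B (x - y) z)\<^sup>2)) / 4)"
      by (intro has_bochner_integral_divide_zero has_bochner_integral_diff squares)
    moreover have "(((x + y) \<bullet> w)\<^sup>2 * (z \<bullet> w)\<^sup>2 - ((x - y) \<bullet> w)\<^sup>2 * (z \<bullet> w)\<^sup>2) / 4
        = (x \<bullet> w) * (y \<bullet> w) * (z \<bullet> w)\<^sup>2" for w
      by (simp add: inner_add_left inner_diff_left power2_eq_square) algebra
    moreover have "((B (x + y) (x + y) * B z z + 2 * (B (x + y) z)\<^sup>2)
          - (B (x - y) (x - y) * B z z + 2 * (B (x - y) z)\<^sup>2)) / 4 = B x y * B z z + 2 * (B x z * B y z)"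
      by (simp add: add diff sym[of y x] power2_eq_square) algebra
    ultimately show ?thesis by (simp only:)
  qed
  have "has_bochner_integral M (\<lambda>\<omega>. ((p \<bullet> X \<omega>) * (q \<bullet> X \<omega>) * ((r + s) \<bullet> X \<omega>)\<^sup>2
        - (p \<bullet> X \<omega>) * (q \<bullet> X \<omega>) * ((r - s) \<bullet> X \<omega>)\<^sup>2) / 4)
      (((B p q * B (r + s) (r + s) + 2 * (B p (r + s) * B q (r + s)))
        - (B p q * B (r - s) (r - s) + 2 * (B p (r - s) * B q (r - s)))) / 4)"
    by (intro has_bochner_integral_divide_zero has_bochner_integral_diff mixed)
  moreover have "((p \<bullet> w) * (q \<bullet> w) * ((r + s) \<bullet> w)\<^sup>2 - (p \<bullet> w) * (q \<bullet> w) * ((r - s) \<bullet> w)\<^sup>2) / 4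
      = (p \<bullet> w) * (q \<bullet> w) * (r \<bullet> w) * (s \<bullet> w)" for w
    by (simp add: inner_add_left inner_diff_left power2_eq_square) algebra
  moreover have "((B p q * B (r + s) (r + s) + 2 * (B p (r + s) * B q (r + s)))
        - (B p q * B (r - s) (r - s) + 2 * (B p (r - s) * B q (r - s)))) / 4
      = B p q * B r s + B p r * B q s + B p s * B q r"
    by (simp add: add diff sym[of s r] power2_eq_square) algebra
  ultimately show ?thesis
    unfolding B_def[symmetric] by (simp only:)
qed

lemma gaussian_vector_component_moments:
  assumes "gaussian_vector M X D"
  shows "has_bochner_integral M (\<lambda>\<omega>. X \<omega> $ i) 0"
    and "has_bochner_integral M (\<lambda>\<omega>. X \<omega> $ i * X \<omega> $ j) (D $ i $ j)"
    and "has_bochner_integral M (\<lambda>\<omega>. X \<omega> $ i * X \<omega> $ j * X \<omega> $ k * X \<omega> $ l)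
      (D $ i $ j * D $ k $ l + D $ i $ k * D $ j $ l + D $ i $ l * D $ j $ k)"
proof -
  show "has_bochner_integral M (\<lambda>\<omega>. X \<omega> $ i) 0"
    using gaussian_vector_linear_form(1)[OF assms, of "axis i 1"] by (simp add: inner_axis')
  show "has_bochner_integral M (\<lambda>\<omega>. X \<omega> $ i * X \<omega> $ j) (D $ i $ j)"
    using gaussian_vector_second_moment[OF assms, of "axis i 1" "axis j 1"]
    by (simp add: inner_axis' matrix_vector_mult_basis column_def)
  show "has_bochner_integral M (\<lambda>\<omega>. X \<omega> $ i * X \<omega> $ j * X \<omega> $ k * X \<omega> $ l)
      (D $ i $ j * D $ k $ l + D $ i $ k * D $ j $ l + D $ i $ l * D $ j $ k)"
    using gaussian_vector_fourth_moment[OF assms, of "axis i 1" "axis j 1" "axis k 1" "axis l 1"]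
    by (simp add: inner_axis' matrix_vector_mult_basis column_def)
qed


section \<open>Square-integrable functions\<close>

definition square_integrable :: "'a measure \<Rightarrow> ('a \<Rightarrow> real) \<Rightarrow> bool" where
  "square_integrable M f \<longleftrightarrow> f \<in> borel_measurable M \<and> integrable M (\<lambda>x. (f x)\<^sup>2)"

lemma square_integrable_mult_integrable:
  assumes "square_integrable M f" "square_integrable M g"
  shows "integrable M (\<lambda>x. f x * g x)"
proof (rule Bochner_Integration.integrable_bound)
  show "integrable M (\<lambda>x. (f x)\<^sup>2 + (g x)\<^sup>2)"
    using assms by (auto simp: square_integrable_def)
  show "(\<lambda>x. f x * g x) \<in> borel_measurable M"
    using assms by (auto simp: square_integrable_def)
  show "AE x in M. norm (f x * g x) \<le> norm ((f x)\<^sup>2 + (g x)\<^sup>2)"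
  proof (intro AE_I2)
    fix x
    have "0 \<le> (\<bar>f x\<bar> - \<bar>g x\<bar>)\<^sup>2" by simp
    then have "2 * (\<bar>f x\<bar> * \<bar>g x\<bar>) \<le> (f x)\<^sup>2 + (g x)\<^sup>2"
      by (simp add: power2_diff)
    moreover have "0 \<le> \<bar>f x\<bar> * \<bar>g x\<bar>" by simp
    ultimately show "norm (f x * g x) \<le> norm ((f x)\<^sup>2 + (g x)\<^sup>2)"
      unfolding real_norm_def abs_mult by linarith
  qed
qed

lemma square_integrable_cmult:
  "square_integrable M f \<Longrightarrow> square_integrable M (\<lambda>x. c * f x)"
  by (auto simp: square_integrable_def power_mult_distrib)

lemma square_integrable_add:
  assumes "square_integrable M f" "square_integrable M g"
  shows "square_integrable M (\<lambda>x. f x + g x)"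
proof -
  have "integrable M (\<lambda>x. (f x)\<^sup>2 + (g x)\<^sup>2 + 2 * (f x * g x))"
    using assms square_integrable_mult_integrable[OF assms]
    by (auto simp: square_integrable_def)
  then show ?thesis
    using assms by (auto simp: square_integrable_def power2_sum mult.assoc)
qed

lemma square_integrable_diff:
  assumes "square_integrable M f" "square_integrable M g"
  shows "square_integrable M (\<lambda>x. f x - g x)"
  using square_integrable_add[OF assms(1) square_integrable_cmult[OF assms(2), of "-1"]] by simp


lemma (in prob_space) has_bochner_integral_constant: "has_bochner_integral M (\<lambda>_. c) (c::real)"
  by (simp add: has_bochner_integral_iff prob_space)


section \<open>Gaussian moments of quadratic features\<close>

lemma V_approx_expand:
  "V_approx x \<theta> = fst \<theta> + (\<Sum>p\<in>UNIV. snd \<theta> $ p * (x $ snd p * x $ fst p))"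
  by (simp add: V_approx_def feature_def inner_prod_def inner_vec_def vec_cols_def outer_def mult_ac)

lemma V_approx_diff: "V_approx x (\<theta> - \<psi>) = V_approx x \<theta> - V_approx x \<psi>"
  and V_approx_scaleR: "V_approx x (c *\<^sub>R \<theta>) = c * V_approx x \<theta>"
  and V_approx_sum: "V_approx x (\<Sum>s\<in>I. \<psi>' s) = (\<Sum>s\<in>I. V_approx x (\<psi>' s))"
  by (simp_all add: V_approx_def inner_diff_right inner_sum_right)

lemma sum_UNIV_pair:
  "(\<Sum>p\<in>UNIV. f (snd p) (fst p)) = (\<Sum>i\<in>UNIV. \<Sum>j\<in>UNIV. f i j)"
  for f :: "'a::finite \<Rightarrow> 'b::finite \<Rightarrow> 'c::comm_monoid_add"
proof -
  have "(\<Sum>p\<in>UNIV. f (snd p) (fst p)) = (\<Sum>j\<in>UNIV. \<Sum>i\<in>UNIV. f i j)"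
    unfolding UNIV_Times_UNIV[symmetric] by (simp add: sum.cartesian_product case_prod_beta)
  then show ?thesis by (simp add: sum.swap[of "\<lambda>j i. f i j"])
qed

lemma V_approx_vec_cols: "V_approx x (a, vec_cols Q) = a + x \<bullet> (Q *v x)"
proof -
  have "(\<Sum>p\<in>UNIV. Q $ snd p $ fst p * (x $ snd p * x $ fst p)) = x \<bullet> (Q *v x)"
    by (subst sum_UNIV_pair[of "\<lambda>i j. Q $ i $ j * (x $ i * x $ j)"])
       (simp add: inner_vec_def matrix_vector_mult_def sum_distrib_left mult_ac)
  then show ?thesis by (simp add: V_approx_expand vec_cols_def)
qed

lemma continuous_on_feature: "continuous_on UNIV feature"
  unfolding feature_def[abs_def] vec_cols_def outer_def
  by (intro continuous_intros)

lemma borel_measurable_feature [measurable]: "feature \<in> borel_measurable borel"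
  using continuous_on_feature by (rule borel_measurable_continuous_onI)

text \<open>The expectation of \<open>(V_approx X \<theta>)\<^sup>2\<close> for a centred Gaussian \<open>X\<close> with covariance \<open>D\<close>, by Isserlis.
  That it is a function of \<open>D\<close> only is the form in which stationarity is used: the states \<open>x\<close> and
  \<open>x'\<close> have the same covariance.\<close>
definition feature_second_moment :: "real^'n^'n \<Rightarrow> 'n feat \<Rightarrow> real" where
  "feature_second_moment D \<theta> = (fst \<theta>)\<^sup>2
     + 2 * fst \<theta> * (\<Sum>p\<in>UNIV. snd \<theta> $ p * D $ snd p $ fst p)
     + (\<Sum>p\<in>UNIV. \<Sum>r\<in>UNIV. snd \<theta> $ p * snd \<theta> $ r *
         (D $ snd p $ fst p * D $ snd r $ fst r + D $ snd p $ snd r * D $ fst p $ fst r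
          + D $ snd p $ fst r * D $ fst p $ snd r))"

lemma V_approx_second_moment:
  assumes "gaussian_vector M X D"
  shows "has_bochner_integral M (\<lambda>\<omega>. (V_approx (X \<omega>) \<theta>)\<^sup>2) (feature_second_moment D \<theta>)"
proof -
  interpret prob_space M using assms by (simp add: gaussian_vector_def)
  note m2 = gaussian_vector_component_moments(2)[OF assms]
  note m4 = gaussian_vector_component_moments(3)[OF assms]
  have "has_bochner_integral M (\<lambda>\<omega>. (fst \<theta>)\<^sup>2
      + 2 * fst \<theta> * (\<Sum>p\<in>UNIV. snd \<theta> $ p * (X \<omega> $ snd p * X \<omega> $ fst p))
      + (\<Sum>p\<in>UNIV. \<Sum>r\<in>UNIV. snd \<theta> $ p * snd \<theta> $ r *
          (X \<omega> $ snd p * X \<omega> $ fst p * X \<omega> $ snd r * X \<omega> $ fst r))) (feature_second_moment D \<theta>)"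
    unfolding feature_second_moment_def
    by (intro has_bochner_integral_add has_bochner_integral_sum has_bochner_integral_mult_right
        has_bochner_integral_constant m2 m4)
  moreover have "(V_approx x \<theta>)\<^sup>2 = (fst \<theta>)\<^sup>2
      + 2 * fst \<theta> * (\<Sum>p\<in>UNIV. snd \<theta> $ p * (x $ snd p * x $ fst p))
      + (\<Sum>p\<in>UNIV. \<Sum>r\<in>UNIV. snd \<theta> $ p * snd \<theta> $ r * (x $ snd p * x $ fst p * x $ snd r * x $ fst r))"
    for x
  proof -
    have "(\<Sum>p\<in>UNIV. snd \<theta> $ p * (x $ snd p * x $ fst p))\<^sup>2
        = (\<Sum>p\<in>UNIV. \<Sum>r\<in>UNIV. snd \<theta> $ p * snd \<theta> $ r * (x $ snd p * x $ fst p * x $ snd r * x $ fst r))"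
      by (simp add: power2_eq_square sum_product mult_ac)
    then show ?thesis
      by (simp add: V_approx_expand power2_sum)
  qed
  ultimately show ?thesis by simp
qed

lemma square_integrable_V_approx:
  assumes "gaussian_vector M X D"
  shows "square_integrable M (\<lambda>\<omega>. V_approx (X \<omega>) \<theta>)"
proof -
  have [measurable]: "X \<in> borel_measurable M"
    using assms by (simp add: gaussian_vector_def)
  show ?thesis
    using V_approx_second_moment[OF assms, of \<theta>]
    by (auto simp: square_integrable_def has_bochner_integral_iff V_approx_def)
qed

text \<open>Cauchy-Schwarz on the diagonal; this is where the dimension enters the bound.\<close>
lemma trace_square_le:
  fixes D :: "real^'n^'n"
  shows "(trace D)\<^sup>2 \<le> real CARD('n) * (frobenius_norm D)\<^sup>2"
proof -
  have "(trace D)\<^sup>2 \<le> real CARD('n) * (\<Sum>i\<in>UNIV. (D $ i $ i)\<^sup>2)"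
    using Cauchy_Schwarz_ineq_sum[of "\<lambda>_. 1" "\<lambda>i. D $ i $ i" UNIV] by (simp add: trace_def)
  also have "(\<Sum>i\<in>UNIV. (D $ i $ i)\<^sup>2) \<le> (\<Sum>i\<in>UNIV. \<Sum>j\<in>UNIV. (D $ i $ j)\<^sup>2)"
    by (intro sum_mono member_le_sum) auto
  finally show ?thesis
    by (simp add: frobenius_norm_def sum_nonneg mult_left_mono)
qed

text \<open>The squared norm of the feature vector is \<open>1 + |x|\<^sup>4\<close>.\<close>
lemma feature_norm_second_moment:
  fixes X :: "'a \<Rightarrow> real^'n"
  assumes "gaussian_vector M X D"
  shows "has_bochner_integral M (\<lambda>\<omega>. (norm (feature (X \<omega>)))\<^sup>2) (1 + (trace D)\<^sup>2 + 2 * (frobenius_norm D)\<^sup>2)"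
proof -
  interpret prob_space M using assms by (simp add: gaussian_vector_def)
  note m4 = gaussian_vector_component_moments(3)[OF assms]
  have "has_bochner_integral M (\<lambda>\<omega>. 1 + (\<Sum>p\<in>UNIV. X \<omega> $ snd p * X \<omega> $ snd p * X \<omega> $ fst p * X \<omega> $ fst p))
      (1 + (\<Sum>p\<in>UNIV. D $ snd p $ snd p * D $ fst p $ fst p + D $ snd p $ fst p * D $ snd p $ fst p
         + D $ snd p $ fst p * D $ snd p $ fst p))"
    by (intro has_bochner_integral_add has_bochner_integral_sum has_bochner_integral_constant m4)
  moreover have "(norm (feature x))\<^sup>2 = 1 + (\<Sum>p\<in>UNIV. x $ snd p * x $ snd p * x $ fst p * x $ fst p)" for x :: "real^'n"
    by (simp add: feature_def power2_norm_eq_inner inner_prod_def inner_vec_def vec_cols_def outer_def mult_ac)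
  moreover have "(\<Sum>p\<in>UNIV. D $ snd p $ snd p * D $ fst p $ fst p + D $ snd p $ fst p * D $ snd p $ fst p
         + D $ snd p $ fst p * D $ snd p $ fst p) = (trace D)\<^sup>2 + 2 * (frobenius_norm D)\<^sup>2"
  proof -
    have tr: "(trace D)\<^sup>2 = (\<Sum>i\<in>UNIV. \<Sum>j\<in>UNIV. D $ i $ i * D $ j $ j)"
      by (simp add: trace_def power2_eq_square sum_product)
    have fro: "(frobenius_norm D)\<^sup>2 = (\<Sum>i\<in>UNIV. \<Sum>j\<in>UNIV. D $ i $ j * D $ i $ j)"
      by (simp add: frobenius_norm_def sum_nonneg power2_eq_square)
    show ?thesis
      by (subst sum_UNIV_pair[of "\<lambda>i j. D $ i $ i * D $ j $ j + D $ i $ j * D $ i $ j + D $ i $ j * D $ i $ j"])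
         (simp add: tr fro sum.distrib sum_distrib_left)
  qed
  ultimately show ?thesis by (simp add: add.assoc)
qed

text \<open>The terms linear in the Gaussian vector have mean zero, which leaves the value at the centre and
  the trace correction of the Bellman equation.\<close>
lemma V_approx_shifted_mean:
  assumes "gaussian_vector M X D"
  shows "has_bochner_integral M (\<lambda>\<omega>. V_approx (c + X \<omega>) (a, vec_cols Q))
    (a + c \<bullet> (Q *v c) + trace (Q ** D))"
proof -
  interpret prob_space M using assms by (simp add: gaussian_vector_def)
  have sym: "D $ i $ j = D $ j $ i" for i j
  proof -
    have "transpose D $ i $ j = D $ i $ j"
      using assms by (simp add: gaussian_vector_def)
    then show ?thesis by (simp add: transpose_def)
  qed
  note m1 = gaussian_vector_component_moments(1)[OF assms]
  note m2 = gaussian_vector_component_moments(2)[OF assms]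
  have "has_bochner_integral M (\<lambda>\<omega>. a + (\<Sum>i\<in>UNIV. \<Sum>j\<in>UNIV. Q $ i $ j *
        (c $ i * c $ j + c $ i * X \<omega> $ j + c $ j * X \<omega> $ i + X \<omega> $ i * X \<omega> $ j)))
      (a + (\<Sum>i\<in>UNIV. \<Sum>j\<in>UNIV. Q $ i $ j * (c $ i * c $ j + c $ i * 0 + c $ j * 0 + D $ i $ j)))"
    by (intro has_bochner_integral_add has_bochner_integral_sum has_bochner_integral_mult_right has_bochner_integral_constant m1 m2)
  moreover have "V_approx (c + x) (a, vec_cols Q) = a + (\<Sum>i\<in>UNIV. \<Sum>j\<in>UNIV. Q $ i $ j *
        (c $ i * c $ j + c $ i * x $ j + c $ j * x $ i + x $ i * x $ j))" for x
    unfolding V_approx_vec_cols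
    by (simp add: inner_vec_def matrix_vector_mult_def sum_distrib_left algebra_simps)
  moreover have "(\<Sum>i\<in>UNIV. \<Sum>j\<in>UNIV. Q $ i $ j * (c $ i * c $ j + c $ i * 0 + c $ j * 0 + D $ i $ j))
      = c \<bullet> (Q *v c) + trace (Q ** D)"
    by (simp add: inner_vec_def matrix_vector_mult_def trace_def matrix_matrix_mult_def
        sum_distrib_left sum.distrib sym algebra_simps)
  ultimately show ?thesis by (simp add: add.assoc)
qed


section \<open>Series of matrices\<close>

lemma bounded_bilinear_matrix_mult:
  "bounded_bilinear ((**) :: real^'m^'n \<Rightarrow> real^'k^'m \<Rightarrow> real^'k^'n)"
  unfolding bilinear_conv_bounded_bilinear[symmetric] bilinear_def
  by (auto simp: linear_iff matrix_add_ldistrib vec_eq_iff matrix_matrix_mult_def sum.distrib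
      sum_distrib_left algebra_simps)

lemma norm_matrix_le_sum_entries:
  fixes P :: "real^'m^'n"
  shows "norm P \<le> (\<Sum>i\<in>UNIV. \<Sum>j\<in>UNIV. \<bar>P $ i $ j\<bar>)"
proof -
  have "norm P \<le> (\<Sum>i\<in>UNIV. norm (P $ i))"
    unfolding norm_vec_def by (rule L2_set_le_sum) simp
  also have "\<dots> \<le> (\<Sum>i\<in>UNIV. \<Sum>j\<in>UNIV. \<bar>P $ i $ j\<bar>)"
    by (intro sum_mono norm_le_l1_cart)
  finally show ?thesis .
qed

lemma summable_sandwich:
  fixes L :: "nat \<Rightarrow> real^'m^'n" and R :: "nat \<Rightarrow> real^'l^'k" and W :: "real^'k^'m"
  assumes s: "0 < s" "s < 1"
    and L: "\<And>k i j. \<bar>L k $ i $ j\<bar> \<le> C * s ^ k" and R: "\<And>k i j. \<bar>R k $ i $ j\<bar> \<le> C * s ^ k"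
  shows "summable (\<lambda>k. L k ** W ** R k)"
proof -
  obtain K1 where K1: "0 < K1" "\<And>P Q. norm ((P :: real^'m^'n) ** (Q :: real^'k^'m)) \<le> norm P * norm Q * K1"
    using bounded_bilinear.pos_bounded[OF bounded_bilinear_matrix_mult] by blast
  obtain K2 where K2: "0 < K2" "\<And>P Q. norm ((P :: real^'k^'n) ** (Q :: real^'l^'k)) \<le> norm P * norm Q * K2"
    using bounded_bilinear.pos_bounded[OF bounded_bilinear_matrix_mult] by blast
  define a where "a = real CARD('n) * (real CARD('m) * C)"
  define b where "b = real CARD('k) * (real CARD('l) * C)"
  have "norm (L k) \<le> (\<Sum>i\<in>(UNIV::'n set). \<Sum>j\<in>(UNIV::'m set). C * s ^ k)" for k
    by (rule order_trans[OF norm_matrix_le_sum_entries]) (intro sum_mono L)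
  then have nL: "norm (L k) \<le> a * s ^ k" for k
    by (simp add: a_def mult.assoc)
  have "norm (R k) \<le> (\<Sum>i\<in>(UNIV::'k set). \<Sum>j\<in>(UNIV::'l set). C * s ^ k)" for k
    by (rule order_trans[OF norm_matrix_le_sum_entries]) (intro sum_mono R)
  then have nR: "norm (R k) \<le> b * s ^ k" for k
    by (simp add: b_def mult.assoc)
  show ?thesis
  proof (rule summable_comparison_test')
    show "summable (\<lambda>k. (a * norm W * K1 * b * K2) * (s * s) ^ k)"
      using s mult_strict_mono[of s 1 s 1] by (intro summable_mult summable_geometric) (simp add: abs_mult)
    fix k :: nat
    have "norm (L k ** W ** R k) \<le> norm (L k ** W) * norm (R k) * K2"
      by (rule K2(2))
    also have "\<dots> \<le> (norm (L k) * norm W * K1) * norm (R k) * K2"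
      using K2(1) by (intro mult_right_mono K1(2)) auto
    also have "\<dots> \<le> ((a * s ^ k) * norm W * K1) * (b * s ^ k) * K2"
      using K1(1) K2(1) order_trans[OF norm_ge_zero nL[of 0]] s(1)
      by (intro mult_right_mono mult_mono nL nR mult_nonneg_nonneg) auto
    also have "\<dots> = (a * norm W * K1 * b * K2) * (s * s) ^ k"
      by (simp add: power_mult_distrib mult_ac)
    finally show "norm (L k ** W ** R k) \<le> (a * norm W * K1 * b * K2) * (s * s) ^ k" .
  qed
qed

lemma matrix_mult_suminf:
  fixes T :: "nat \<Rightarrow> real^'m^'n" and P :: "real^'n^'k" and Q :: "real^'l^'m"
  assumes "summable T"
  shows "P ** (\<Sum>i. T i) ** Q = (\<Sum>i. P ** T i ** Q)"
proof -
  have 1: "bounded_linear (\<lambda>T. P ** T)"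
    by (rule bounded_bilinear.bounded_linear_right[OF bounded_bilinear_matrix_mult])
  have 2: "bounded_linear (\<lambda>T. T ** Q)"
    by (rule bounded_bilinear.bounded_linear_left[OF bounded_bilinear_matrix_mult])
  have "bounded_linear (\<lambda>T. P ** T ** Q)"
    using bounded_linear_compose[OF 2 1] .
  from bounded_linear.suminf[OF this assms] show ?thesis by simp
qed


section \<open>The closed-loop system\<close>

lemma state_cov_summable:
  assumes "stable_policy A B K"
  shows "summable (\<lambda>i. mat_power (A + B ** K) i ** W ** transpose (mat_power (A + B ** K) i))"
proof -
  have "spec_radius (A + B ** K) < 1"
    using assms by (simp add: stable_policy_def)
  then obtain s C where s: "0 < s" "s < 1"
      and C: "\<And>k i j. \<bar>mat_power (A + B ** K) k $ i $ j\<bar> \<le> C * s ^ k"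
    by (rule mat_power_geometric_decay) (rule that)
  show ?thesis
    by (rule summable_sandwich[OF s C]) (simp add: transpose_def C)
qed

text \<open>Splitting off the first term of the series: \<open>x' = F x + w\<close> has the covariance of \<open>x\<close>.\<close>
lemma state_cov_lyapunov:
  fixes A :: "real^'n^'n" and B :: "real^'d^'n"
  assumes "stable_policy A B K"
  defines "F \<equiv> A + B ** K"
  shows "state_cov A B \<sigma> D\<^sub>\<omega> K
    = F ** state_cov A B \<sigma> D\<^sub>\<omega> K ** transpose F + total_noise_cov B \<sigma> D\<^sub>\<omega>"
proof -
  define W where "W = total_noise_cov B \<sigma> D\<^sub>\<omega>"
  define T where "T i = mat_power F i ** W ** transpose (mat_power F i)" for i
  have summable: "summable T"
    unfolding T_def[abs_def] F_def by (rule state_cov_summable[OF assms(1)])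
  have cov: "state_cov A B \<sigma> D\<^sub>\<omega> K = (\<Sum>i. T i)"
    by (simp add: state_cov_def T_def F_def W_def)
  have Suc: "T (Suc i) = F ** T i ** transpose F" for i
    by (simp add: T_def matrix_transpose_mul matrix_mul_assoc)
  have "(\<Sum>i. T i) = (\<Sum>i. T (Suc i)) + T 0"
    using suminf_split_head[OF summable] by simp
  also have "(\<Sum>i. T (Suc i)) = F ** (\<Sum>i. T i) ** transpose F"
    unfolding Suc by (rule matrix_mult_suminf[OF summable, symmetric])
  finally show ?thesis by (simp add: cov T_def flip: W_def)
qed

lemma bounded_linear_quadratic_form: "bounded_linear (\<lambda>M::real^'n^'n. v \<bullet> (M *v v))"
  unfolding linear_conv_bounded_linear[symmetric]
  by (auto simp: linear_iff matrix_vector_mult_add_rdistrib inner_add_right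
      simp flip: scaleR_matrix_vector_assoc)

lemma bounded_linear_transpose: "bounded_linear (transpose :: real^'n^'m \<Rightarrow> real^'m^'n)"
  unfolding linear_conv_bounded_linear[symmetric]
  by (auto simp: linear_iff transpose_def vec_eq_iff)

text \<open>Positive definiteness makes the stationary distribution a genuine density; the first term of the
  series is the noise covariance, and the other ones are positive semidefinite.\<close>
lemma sym_pos_def_state_cov:
  fixes A :: "real^'n^'n" and B :: "real^'d^'n"
  assumes "stable_policy A B K" and W: "sym_pos_def (total_noise_cov B \<sigma> D\<^sub>\<omega>)"
  shows "sym_pos_def (state_cov A B \<sigma> D\<^sub>\<omega> K)"
proof -
  define F where "F = A + B ** K"
  define W where "W = total_noise_cov B \<sigma> D\<^sub>\<omega>"
  define D where "D = state_cov A B \<sigma> D\<^sub>\<omega> K"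
  define T where "T i = mat_power F i ** W ** transpose (mat_power F i)" for i
  have summable: "summable T"
    unfolding T_def[abs_def] F_def by (rule state_cov_summable[OF assms(1)])
  have D: "D = (\<Sum>i. T i)"
    by (simp add: D_def state_cov_def T_def F_def W_def)
  have symW: "transpose W = W" and posW: "\<And>x. x \<noteq> 0 \<Longrightarrow> 0 < x \<bullet> (W *v x)"
    using W by (auto simp: sym_pos_def_def W_def)
  have nonnegW: "0 \<le> x \<bullet> (W *v x)" for x
    using posW[of x] by (cases "x = 0") auto
  have "transpose (T i) = T i" for i
    by (simp add: T_def matrix_transpose_mul matrix_mul_assoc symW)
  then have "transpose D = D"
    using bounded_linear.suminf[OF bounded_linear_transpose summable] by (simp add: D)
  moreover have "0 < x \<bullet> (D *v x)" if "x \<noteq> 0" for x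
  proof -
    have T: "x \<bullet> (T i *v x) = (transpose (mat_power F i) *v x) \<bullet> (W *v (transpose (mat_power F i) *v x))" for i
      by (simp add: T_def inner_matrix_transpose[of x "mat_power F i"] flip: matrix_vector_mul_assoc)
    have "x \<bullet> (D *v x) = (\<Sum>i. x \<bullet> (T i *v x))"
      using bounded_linear.suminf[OF bounded_linear_quadratic_form summable] by (simp add: D)
    moreover have "summable (\<lambda>i. x \<bullet> (T i *v x))"
      by (rule bounded_linear.summable[OF bounded_linear_quadratic_form summable])
    moreover have "x \<bullet> (T 0 *v x) > 0"
      using posW[OF that] by (simp add: T_def)
    ultimately show ?thesis
      by (metis T nonnegW suminf_pos2)
  qed
  ultimately show ?thesis by (simp add: sym_pos_def_def D_def)
qed

text \<open>Splitting off the first term of the series gives the Bellman equation for the quadratic part of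
  the value function.\<close>
lemma value_matrix_fixed_point:
  fixes A :: "real^'n^'n" and B :: "real^'d^'n" and S :: "real^'n^'n" and R :: "real^'d^'d"
  assumes "stable_policy A B K" and "0 < \<gamma>" and "\<gamma> < 1"
  defines "F \<equiv> A + B ** K" and "P \<equiv> value_matrix A B S R \<gamma> K"
  shows "P = (S + transpose K ** R ** K) + \<gamma> *\<^sub>R (transpose F ** P ** F)"
proof -
  define Q where "Q = S + transpose K ** R ** K"
  define T where "T i = \<gamma> ^ i *\<^sub>R (transpose (mat_power F i) ** Q ** mat_power F i)" for i
  \<comment> \<open>The recursion multiplies on the left, while the series is shifted by a factor on the right.\<close>
  have comm: "F ** mat_power F i = mat_power F i ** F" for i
    by (induction i) (simp_all add: matrix_mul_assoc)
  have scaleR: "M ** (c *\<^sub>R N) = c *\<^sub>R (M ** N)" "(c *\<^sub>R M) ** N = c *\<^sub>R (M ** N)"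
    for c and M N :: "real^'n^'n"
    by (simp_all add: vec_eq_iff matrix_matrix_mult_def sum_distrib_left mult_ac)
  have "spec_radius F < 1"
    using assms(1) by (simp add: stable_policy_def F_def)
  then obtain s C where s: "0 < s" "s < 1" and C: "\<And>k i j. \<bar>mat_power F k $ i $ j\<bar> \<le> C * s ^ k"
    by (rule mat_power_geometric_decay) (rule that)
  have summable: "summable T"
  proof -
    have "summable (\<lambda>k. transpose (mat_power F k) ** Q ** (\<gamma> ^ k *\<^sub>R mat_power F k))"
    proof (rule summable_sandwich[OF s])
      show "\<bar>transpose (mat_power F k) $ i $ j\<bar> \<le> C * s ^ k" for k i j
        by (simp add: transpose_def C)
      show "\<bar>(\<gamma> ^ k *\<^sub>R mat_power F k) $ i $ j\<bar> \<le> C * s ^ k" for k i j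
      proof -
        have "\<bar>(\<gamma> ^ k *\<^sub>R mat_power F k) $ i $ j\<bar> = \<gamma> ^ k * \<bar>mat_power F k $ i $ j\<bar>"
          using assms(2) by (simp add: abs_mult)
        also have "\<dots> \<le> 1 * \<bar>mat_power F k $ i $ j\<bar>"
          using assms(2,3) by (intro mult_right_mono power_le_one) auto
        finally show ?thesis using C[of k i j] by simp
      qed
    qed
    then show ?thesis by (simp add: T_def[abs_def] scaleR)
  qed
  have P: "P = (\<Sum>i. T i)"
    by (simp add: P_def value_matrix_def T_def F_def Q_def)
  have Suc: "T (Suc i) = transpose F ** T i ** (\<gamma> *\<^sub>R F)" for i
    by (simp add: T_def comm matrix_transpose_mul matrix_mul_assoc scaleR)
  have "P = (\<Sum>i. T (Suc i)) + T 0"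
    using suminf_split_head[OF summable] by (simp add: P)
  also have "(\<Sum>i. T (Suc i)) = transpose F ** P ** (\<gamma> *\<^sub>R F)"
    unfolding Suc P by (rule matrix_mult_suminf[OF summable, symmetric])
  also have "T 0 = Q" by (simp add: T_def)
  finally show ?thesis by (simp add: Q_def scaleR add.commute)
qed

lemma gaussian_vector_eta_dist:
  assumes "\<sigma> > 0"
  shows "gaussian_vector (eta_dist \<sigma>) (\<lambda>\<eta>. \<eta>) (\<sigma>\<^sup>2 *\<^sub>R mat 1)"
  unfolding eta_dist_def
  by (rule gaussian_vector_gaussian) (use assms in
      \<open>simp add: sym_pos_def_def transpose_scalar scaleR_matrix_vector_assoc[symmetric]\<close>)

lemma gaussian_vector_noise:
  fixes G :: "real^'d^'k" and H :: "real^'n^'k" and D\<^sub>\<omega> :: "real^'n^'n"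
  assumes "sym_pos_def D\<^sub>\<omega>" and "\<sigma> > 0"
  shows "gaussian_vector (noise_dist \<sigma> D\<^sub>\<omega>) (\<lambda>(\<eta>, \<omega>). G *v \<eta> + H *v \<omega>)
    (\<sigma>\<^sup>2 *\<^sub>R (G ** transpose G) + H ** D\<^sub>\<omega> ** transpose H)"
proof -
  have "gaussian_vector (noise_dist \<sigma> D\<^sub>\<omega>) (\<lambda>(\<eta>, \<omega>). G *v \<eta> + H *v \<omega>)
    (G ** (\<sigma>\<^sup>2 *\<^sub>R mat 1) ** transpose G + H ** D\<^sub>\<omega> ** transpose H)"
    unfolding noise_dist_def
    by (intro gaussian_vector_affine_pair gaussian_vector_eta_dist[OF assms(2)]
        gaussian_vector_gaussian assms)
  moreover have "G ** (\<sigma>\<^sup>2 *\<^sub>R mat 1) = \<sigma>\<^sup>2 *\<^sub>R G"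
    by (simp add: vec_eq_iff matrix_matrix_mult_def mat_def if_distrib cong: if_cong)
  moreover have "(\<sigma>\<^sup>2 *\<^sub>R G) ** transpose G = \<sigma>\<^sup>2 *\<^sub>R (G ** transpose G)"
    by (simp add: vec_eq_iff matrix_matrix_mult_def sum_distrib_left mult.assoc)
  ultimately show ?thesis by simp
qed

text \<open>A matrix is the combination of the matrix units with its entries, so the matrix-valued integral
  can be read off from the second moments of the components.\<close>
lemma total_noise_cov_eq:
  fixes B :: "real^'d^'n" and D\<^sub>\<omega> :: "real^'n^'n"
  assumes "sym_pos_def D\<^sub>\<omega>" and "\<sigma> > 0"
  shows "total_noise_cov B \<sigma> D\<^sub>\<omega> = \<sigma>\<^sup>2 *\<^sub>R (B ** transpose B) + D\<^sub>\<omega>"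
proof -
  define W where "W = \<sigma>\<^sup>2 *\<^sub>R (B ** transpose B) + D\<^sub>\<omega>"
  define w where "w = (\<lambda>(\<eta>, \<omega>). B *v \<eta> + (\<omega>::real^'n))"
  have gauss: "gaussian_vector (noise_dist \<sigma> D\<^sub>\<omega>) w W"
    using gaussian_vector_noise[OF assms, of B "mat 1"]
    by (simp add: w_def W_def)
  have "has_bochner_integral (noise_dist \<sigma> D\<^sub>\<omega>)
      (\<lambda>n. \<Sum>i\<in>UNIV. \<Sum>j\<in>UNIV. (w n $ i * w n $ j) *\<^sub>R axis i (axis j 1))
      (\<Sum>i\<in>UNIV. \<Sum>j\<in>UNIV. W $ i $ j *\<^sub>R axis i (axis j 1) :: real^'n^'n)"
    by (intro has_bochner_integral_sum has_bochner_integral_scaleR_left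
        gaussian_vector_component_moments(2)[OF gauss])
  moreover have matrix_sum: "(\<Sum>i\<in>UNIV. \<Sum>j\<in>UNIV. M $ i $ j *\<^sub>R axis i (axis j 1)) = M" for M :: "real^'n^'n"
  proof -
    have "(\<Sum>i\<in>UNIV. \<Sum>j\<in>UNIV. M $ i $ j *\<^sub>R axis i (axis j 1)) $ a $ b
        = (\<Sum>i\<in>UNIV. if i = a then \<Sum>j\<in>UNIV. if j = b then M $ i $ j else 0 else 0)" for a b
    proof -
      have "(M $ i $ j *\<^sub>R axis i (axis j 1)) $ a $ b = (if i = a then if j = b then M $ i $ j else 0 else 0)" for i j
        by (simp add: axis_def)
      then show ?thesis
        by (simp only: sum_component) (intro sum.cong refl, simp)
    qed
    then show ?thesis by (simp add: vec_eq_iff)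
  qed
  ultimately have "has_bochner_integral (noise_dist \<sigma> D\<^sub>\<omega>) (\<lambda>n. outer (w n) (w n)) W"
    using matrix_sum[of "outer (w n) (w n)" for n] by (simp add: outer_def)
  then show ?thesis
    by (simp add: total_noise_cov_def w_def W_def has_bochner_integral_iff split_beta')
qed

lemma sym_pos_def_total_noise_cov:
  fixes B :: "real^'d^'n" and D\<^sub>\<omega> :: "real^'n^'n"
  assumes "sym_pos_def D\<^sub>\<omega>" and "\<sigma> > 0"
  shows "sym_pos_def (total_noise_cov B \<sigma> D\<^sub>\<omega>)"
proof -
  have "transpose (\<sigma>\<^sup>2 *\<^sub>R (B ** transpose B) + D\<^sub>\<omega>) = \<sigma>\<^sup>2 *\<^sub>R (B ** transpose B) + D\<^sub>\<omega>"
    using gaussian_vector_noise[OF assms, of B "mat 1"] by (simp add: gaussian_vector_def)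
  moreover have "0 < x \<bullet> ((\<sigma>\<^sup>2 *\<^sub>R (B ** transpose B) + D\<^sub>\<omega>) *v x)" if "x \<noteq> 0" for x
  proof -
    have "x \<bullet> ((\<sigma>\<^sup>2 *\<^sub>R (B ** transpose B) + D\<^sub>\<omega>) *v x)
        = \<sigma>\<^sup>2 * ((transpose B *v x) \<bullet> (transpose B *v x)) + x \<bullet> (D\<^sub>\<omega> *v x)"
      by (simp add: matrix_vector_mult_add_rdistrib inner_add_right inner_matrix_transpose[of x B]
          flip: matrix_vector_mul_assoc scaleR_matrix_vector_assoc)
    moreover have "0 < x \<bullet> (D\<^sub>\<omega> *v x)"
      using assms(1) that by (simp add: sym_pos_def_def)
    ultimately show ?thesis
      by (simp add: add_nonneg_pos)
  qed
  ultimately show ?thesis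
    by (simp add: total_noise_cov_eq[OF assms] sym_pos_def_def)
qed


section \<open>The mean temporal-difference update\<close>

text \<open>The Bellman equation for \<open>V_approx _ (theta_star \<dots>)\<close>, at every fixed state: the value matrix cancels
  the quadratic part, and the constant of \<open>theta_star\<close> is chosen to cancel the noise contributions.\<close>
lemma bellman_residual_mean_zero:
  fixes A :: "real^'n^'n" and B :: "real^'d^'n" and S :: "real^'n^'n" and R :: "real^'d^'d"
    and D\<^sub>\<omega> :: "real^'n^'n" and K :: "real^'n^'d"
  assumes "sym_pos_def D\<^sub>\<omega>" and "\<sigma> > 0" and "0 < \<gamma>" and "\<gamma> < 1" and "stable_policy A B K"
  shows "(\<integral>(\<eta>, \<omega>). td_error S R \<gamma> x (K *v x + \<eta>) ((A + B ** K) *v x + B *v \<eta> + \<omega>)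
            (theta_star A B S R \<sigma> \<gamma> D\<^sub>\<omega> K) \<partial>noise_dist \<sigma> D\<^sub>\<omega>) = 0"
proof -
  define F where "F = A + B ** K"
  define P where "P = value_matrix A B S R \<gamma> K"
  define W where "W = total_noise_cov B \<sigma> D\<^sub>\<omega>"
  define N :: "((real^'d) \<times> (real^'n)) measure" where "N = noise_dist \<sigma> D\<^sub>\<omega>"
  define \<theta>\<^sub>0 where "\<theta>\<^sub>0 = \<gamma> / (1 - \<gamma>) * trace (P ** W) + \<sigma>\<^sup>2 * trace R / (1 - \<gamma>)"
  have theta: "theta_star A B S R \<sigma> \<gamma> D\<^sub>\<omega> K = (\<theta>\<^sub>0, vec_cols P)"
    by (simp add: theta_star_def \<theta>\<^sub>0_def P_def W_def)
  have gauss_eta: "gaussian_vector N (\<lambda>(\<eta>, \<omega>). \<eta>) (\<sigma>\<^sup>2 *\<^sub>R mat 1)"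
    using gaussian_vector_noise[OF assms(1,2), of "mat 1" "0 :: real^'n^'d"] by (simp add: N_def)
  have gauss_w: "gaussian_vector N (\<lambda>(\<eta>, \<omega>). B *v \<eta> + \<omega>) W"
    using gaussian_vector_noise[OF assms(1,2), of B "mat 1"]
    by (simp add: N_def W_def total_noise_cov_eq[OF assms(1,2)])
  interpret prob_space N using gauss_w by (simp add: gaussian_vector_def)
  have tr: "trace (R ** (\<sigma>\<^sup>2 *\<^sub>R mat 1)) = \<sigma>\<^sup>2 * trace R"
    by (simp add: trace_def matrix_matrix_mult_def mat_def sum_distrib_left if_distrib mult.commute cong: if_cong)
  have "has_bochner_integral N (\<lambda>n. V_approx x (\<theta>\<^sub>0, vec_cols P)
        - (x \<bullet> (S *v x) + V_approx (K *v x + (case n of (\<eta>, \<omega>) \<Rightarrow> \<eta>)) (0, vec_cols R))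
        - \<gamma> * V_approx (F *v x + (case n of (\<eta>, \<omega>) \<Rightarrow> B *v \<eta> + \<omega>)) (\<theta>\<^sub>0, vec_cols P))
      (V_approx x (\<theta>\<^sub>0, vec_cols P)
        - (x \<bullet> (S *v x) + (0 + (K *v x) \<bullet> (R *v (K *v x)) + trace (R ** (\<sigma>\<^sup>2 *\<^sub>R mat 1))))
        - \<gamma> * (\<theta>\<^sub>0 + (F *v x) \<bullet> (P *v (F *v x)) + trace (P ** W)))"
    by (intro has_bochner_integral_diff has_bochner_integral_add has_bochner_integral_mult_right has_bochner_integral_constant
        V_approx_shifted_mean gauss_eta gauss_w)
  moreover have "V_approx x (\<theta>\<^sub>0, vec_cols P)
        - (x \<bullet> (S *v x) + V_approx (K *v x + (case n of (\<eta>, \<omega>) \<Rightarrow> \<eta>)) (0, vec_cols R))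
        - \<gamma> * V_approx (F *v x + (case n of (\<eta>, \<omega>) \<Rightarrow> B *v \<eta> + \<omega>)) (\<theta>\<^sub>0, vec_cols P)
      = (case n of (\<eta>, \<omega>) \<Rightarrow> td_error S R \<gamma> x (K *v x + \<eta>) (F *v x + B *v \<eta> + \<omega>) (\<theta>\<^sub>0, vec_cols P))"
    for n
    by (simp add: td_error_def cost_def V_approx_vec_cols[of _ 0] add.assoc split: prod.split)
  moreover have "V_approx x (\<theta>\<^sub>0, vec_cols P)
        - (x \<bullet> (S *v x) + (0 + (K *v x) \<bullet> (R *v (K *v x)) + trace (R ** (\<sigma>\<^sup>2 *\<^sub>R mat 1))))
        - \<gamma> * (\<theta>\<^sub>0 + (F *v x) \<bullet> (P *v (F *v x)) + trace (P ** W)) = 0"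
  proof -
    have "P = (S + transpose K ** R ** K) + \<gamma> *\<^sub>R (transpose F ** P ** F)"
      unfolding P_def F_def by (rule value_matrix_fixed_point[OF assms(5,3,4)])
    then have "x \<bullet> (P *v x) = x \<bullet> (((S + transpose K ** R ** K) + \<gamma> *\<^sub>R (transpose F ** P ** F)) *v x)"
      by simp
    also have "\<dots> = x \<bullet> (S *v x) + (K *v x) \<bullet> (R *v (K *v x)) + \<gamma> * ((F *v x) \<bullet> (P *v (F *v x)))"
      by (simp add: matrix_vector_mult_add_rdistrib inner_add_right inner_matrix_transpose[of x "transpose _"]
          del: transpose_matrix_vector flip: matrix_vector_mul_assoc scaleR_matrix_vector_assoc)
    finally have quad: "x \<bullet> (P *v x) = \<dots>" .
    have "(1 - \<gamma>) * \<theta>\<^sub>0 = \<gamma> * trace (P ** W) + \<sigma>\<^sup>2 * trace R"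
      using assms(4) by (simp add: \<theta>\<^sub>0_def distrib_left)
    then show ?thesis
      unfolding V_approx_vec_cols tr quad by (simp add: algebra_simps)
  qed
  ultimately show ?thesis
    by (simp add: theta has_bochner_integral_iff flip: F_def N_def)
qed

text \<open>The margin that makes the step size work. Here \<open>e\<close> is \<open>E[\<xi>\<^sup>2]\<close>, \<open>c\<close> is \<open>E[\<xi> \<xi>']\<close>, and \<open>h\<close> the squared norm
  of the update. Bounding \<open>E[(\<xi> - \<gamma> \<xi>')\<^sup>2]\<close> by \<open>(1 + \<gamma>)\<^sup>2 e\<close> would lose the whole margin as \<open>\<gamma>\<close> tends
  to 1. Keeping \<open>c\<close> in both terms, the margin is linear in \<open>e\<close> and \<open>d = e - c \<ge> 0\<close>, with
  nonnegative coefficients.\<close>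
lemma td_descent_arithmetic:
  fixes L \<gamma> c e :: real
  assumes "0 < L" "0 < \<gamma>" "\<gamma> < 1" "0 \<le> e" "c \<le> e"
    and \<alpha>: "\<alpha> = (1 - \<gamma>) / (2 * L)"
    and h: "h \<le> L * ((1 + \<gamma>\<^sup>2) * e - 2 * \<gamma> * c)"
  shows "\<alpha>\<^sup>2 * h - 2 * \<alpha> * (e - \<gamma> * c) \<le> - ((1 - \<gamma>)\<^sup>2 / (2 * L) * e)"
proof -
  define g where "g = 1 - \<gamma>"
  define d where "d = e - c"
  have g: "0 < g" "g < 1" and d: "0 \<le> d" using assms by (auto simp: g_def d_def)
  have "\<alpha>\<^sup>2 * h \<le> \<alpha>\<^sup>2 * (L * ((1 + \<gamma>\<^sup>2) * e - 2 * \<gamma> * c))"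
    using h by (intro mult_left_mono) auto
  moreover have "\<alpha>\<^sup>2 * (L * ((1 + \<gamma>\<^sup>2) * e - 2 * \<gamma> * c)) - 2 * \<alpha> * (e - \<gamma> * c) + g\<^sup>2 / (2 * L) * e
      = - (g / L) * (e * g * (1 / 2 - g\<^sup>2 / 4) + \<gamma> * d * (1 - g / 2))"
    using assms(1) by (simp add: \<alpha> g_def d_def power2_eq_square field_simps)
  moreover have "0 \<le> (g / L) * (e * g * (1 / 2 - g\<^sup>2 / 4) + \<gamma> * d * (1 - g / 2))"
  proof -
    have "g\<^sup>2 \<le> 1" using g by (simp add: power_le_one)
    then show ?thesis
      using g d assms(1,2,4) by (intro mult_nonneg_nonneg add_nonneg_nonneg) auto
  qed
  ultimately show ?thesis by (simp add: g_def)
qed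

text \<open>One update decreases the squared distance to \<open>theta_star\<close>. With \<open>\<xi> = V_approx x (\<theta> - \<theta>')\<close> and
  \<open>\<xi>' = V_approx x' (\<theta> - \<theta>')\<close>, the Bellman equation turns the semi-gradient into \<open>E[(\<xi> - \<gamma> \<xi>') \<phi>(x)]\<close>.
  Its inner product with \<open>\<theta> - \<theta>'\<close> is \<open>e - \<gamma> c\<close>, and its squared norm is at most
  \<open>E|\<phi>|\<^sup>2 E[(\<xi> - \<gamma> \<xi>')\<^sup>2]\<close>, where stationarity gives \<open>E[\<xi>'\<^sup>2] = e\<close> and hence \<open>c \<le> e\<close>.\<close>
lemma td_descent:
  fixes A :: "real^'n^'n" and B :: "real^'d^'n" and S :: "real^'n^'n" and R :: "real^'d^'d"
    and D\<^sub>\<omega> :: "real^'n^'n" and K :: "real^'n^'d" and \<theta> :: "'n feat"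
  assumes "sym_pos_def D\<^sub>\<omega>" and "\<sigma> > 0" and "0 < \<gamma>" and "\<gamma> < 1" and "stable_policy A B K"
    and L: "L = 1 + (real CARD('n) + 2) * (frobenius_norm (state_cov A B \<sigma> D\<^sub>\<omega> K))\<^sup>2"
    and \<alpha>: "\<alpha> = (1 - \<gamma>) / (2 * L)"
  defines "\<theta>' \<equiv> theta_star A B S R \<sigma> \<gamma> D\<^sub>\<omega> K"
  shows "(norm (\<theta> - \<alpha> *\<^sub>R semi_gradient A B S R \<sigma> \<gamma> D\<^sub>\<omega> K \<theta> - \<theta>'))\<^sup>2
    \<le> (norm (\<theta> - \<theta>'))\<^sup>2
      - (1 - \<gamma>)\<^sup>2 / (2 * L) * (\<integral>x. (V_approx x \<theta> - V_approx x \<theta>')\<^sup>2 \<partial>state_dist A B \<sigma> D\<^sub>\<omega> K)"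
proof -
  define F where "F = A + B ** K"
  define W where "W = total_noise_cov B \<sigma> D\<^sub>\<omega>"
  define D where "D = state_cov A B \<sigma> D\<^sub>\<omega> K"
  define \<mu> where "\<mu> = state_dist A B \<sigma> D\<^sub>\<omega> K"
  define N :: "((real^'d) \<times> (real^'n)) measure" where "N = noise_dist \<sigma> D\<^sub>\<omega>"
  define \<Omega> where "\<Omega> = \<mu> \<Otimes>\<^sub>M N"
  define x' where "x' = (\<lambda>(x, n). F *v x + (case n of (\<eta>, \<omega>) \<Rightarrow> B *v \<eta> + \<omega>))"
  define u where "u = (\<lambda>(x, n). K *v x + (case n of (\<eta>, \<omega> :: real^'n) \<Rightarrow> \<eta>))"
  define \<Delta> where "\<Delta> = \<theta> - \<theta>'"
  define \<phi> where "\<phi> p = feature (fst p)" for p :: "(real^'n) \<times> (real^'d) \<times> (real^'n)"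
  define \<xi> where "\<xi> p = V_approx (fst p) \<Delta>" for p :: "(real^'n) \<times> (real^'d) \<times> (real^'n)"
  define \<xi>' where "\<xi>' p = V_approx (x' p) \<Delta>" for p
  define \<delta> where "\<delta> \<psi> p = td_error S R \<gamma> (fst p) (u p) (x' p) \<psi>" for \<psi> p
  have W_pd: "sym_pos_def W"
    unfolding W_def by (rule sym_pos_def_total_noise_cov[OF assms(1,2)])
  have D_pd: "sym_pos_def D"
    unfolding D_def using assms(5) W_pd by (intro sym_pos_def_state_cov) (simp_all add: W_def)
  have gauss_\<mu>: "gaussian_vector \<mu> (\<lambda>x. x) D"
    unfolding \<mu>_def state_dist_def D_def[symmetric] by (rule gaussian_vector_gaussian[OF D_pd])
  have gauss_eta: "gaussian_vector N (\<lambda>(\<eta>, \<omega>). \<eta>) (\<sigma>\<^sup>2 *\<^sub>R mat 1)"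
    using gaussian_vector_noise[OF assms(1,2), of "mat 1" "0 :: real^'n^'d"] by (simp add: N_def)
  have gauss_w: "gaussian_vector N (\<lambda>(\<eta>, \<omega>). B *v \<eta> + \<omega>) W"
    using gaussian_vector_noise[OF assms(1,2), of B "mat 1"]
    by (simp add: N_def W_def total_noise_cov_eq[OF assms(1,2)])
  interpret \<mu>: prob_space \<mu> using gauss_\<mu> by (simp add: gaussian_vector_def)
  interpret N: prob_space N using gauss_w by (simp add: gaussian_vector_def)
  interpret pair_prob_space \<mu> N ..
  have gauss_x: "gaussian_vector \<Omega> fst D"
    using gaussian_vector_affine_pair[OF gauss_\<mu> gauss_w, of "mat 1" "0 :: real^'n^'n"]
    by (simp add: \<Omega>_def split_def)
  have gauss_x': "gaussian_vector \<Omega> x' D"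
    using gaussian_vector_affine_pair[OF gauss_\<mu> gauss_w, of F "mat 1"]
      state_cov_lyapunov[OF assms(5), of \<sigma> D\<^sub>\<omega>]
    by (simp add: \<Omega>_def x'_def F_def D_def W_def)
  obtain D\<^sub>u where gauss_u: "gaussian_vector \<Omega> u D\<^sub>u"
    using gaussian_vector_affine_pair[OF gauss_\<mu> gauss_eta, of K "mat 1"]
    by (simp add: \<Omega>_def u_def)
  have L2_V: "square_integrable \<Omega> (\<lambda>p. V_approx (fst p) \<psi>)" "square_integrable \<Omega> (\<lambda>p. V_approx (x' p) \<psi>)" for \<psi>
    by (rule square_integrable_V_approx[OF gauss_x], rule square_integrable_V_approx[OF gauss_x'])
  have \<delta>_V: "\<delta> \<psi> p = V_approx (fst p) \<psi> - (V_approx (fst p) (0, vec_cols S) + V_approx (u p) (0, vec_cols R))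
      - \<gamma> * V_approx (x' p) \<psi>" for \<psi> p
    by (simp add: \<delta>_def td_error_def cost_def V_approx_vec_cols)
  have L2_\<delta>: "square_integrable \<Omega> (\<delta> \<psi>)" for \<psi>
    unfolding \<delta>_V[abs_def]
    by (intro square_integrable_diff square_integrable_add square_integrable_cmult L2_V
        square_integrable_V_approx[OF gauss_u])
  have L2_\<xi>: "square_integrable \<Omega> \<xi>" "square_integrable \<Omega> \<xi>'"
    unfolding \<xi>_def[abs_def] \<xi>'_def[abs_def] by (rule L2_V)+
  have \<phi>_meas [measurable]: "\<phi> \<in> borel_measurable \<Omega>"
    using gauss_x by (auto simp: gaussian_vector_def \<phi>_def[abs_def])
  have \<phi>_norm: "has_bochner_integral \<Omega> (\<lambda>p. (norm (\<phi> p))\<^sup>2) (1 + (trace D)\<^sup>2 + 2 * (frobenius_norm D)\<^sup>2)"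
    unfolding \<phi>_def by (rule feature_norm_second_moment[OF gauss_x])
  have L2_norm_\<phi>: "square_integrable \<Omega> (\<lambda>p. norm (\<phi> p))"
    using \<phi>_norm by (auto simp: square_integrable_def has_bochner_integral_iff)
  have L2_inner_\<phi>: "square_integrable \<Omega> (\<lambda>p. \<phi> p \<bullet> v)" for v
    using L2_V(1)[of v] by (simp add: \<phi>_def V_approx_def)
  have L_ge: "1 + (trace D)\<^sup>2 + 2 * (frobenius_norm D)\<^sup>2 \<le> L"
    using trace_square_le[of D] by (simp add: L D_def algebra_simps)
  have L_pos: "0 < L"
    by (simp add: L add_pos_nonneg)

  define h where "h = semi_gradient A B S R \<sigma> \<gamma> D\<^sub>\<omega> K \<theta>"
  have h: "h = (\<integral>p. \<delta> \<theta> p *\<^sub>R \<phi> p \<partial>\<Omega>)"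
  proof -
    have "(case p of (x, \<eta>, \<omega>) \<Rightarrow> td_error S R \<gamma> x (K *v x + \<eta>) ((A + B ** K) *v x + B *v \<eta> + \<omega>) \<theta> *\<^sub>R feature x)
        = \<delta> \<theta> p *\<^sub>R \<phi> p" for p
      by (simp add: \<delta>_def \<phi>_def u_def x'_def F_def add.assoc split: prod.split)
    then show ?thesis
      unfolding h_def semi_gradient_def \<Omega>_def \<mu>_def N_def
      by (intro Bochner_Integration.integral_cong refl)
  qed
  have \<delta>\<phi>_int: "integrable \<Omega> (\<lambda>p. \<delta> \<theta> p *\<^sub>R \<phi> p)"
  proof (rule Bochner_Integration.integrable_bound)
    show "integrable \<Omega> (\<lambda>p. \<delta> \<theta> p * norm (\<phi> p))"
      by (rule square_integrable_mult_integrable[OF L2_\<delta> L2_norm_\<phi>])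
    show "(\<lambda>p. \<delta> \<theta> p *\<^sub>R \<phi> p) \<in> borel_measurable \<Omega>"
      using L2_\<delta>[of \<theta>] by (auto simp: square_integrable_def)
  qed simp
  have bellman: "(\<integral>p. \<delta> \<theta>' p * (\<phi> p \<bullet> v) \<partial>\<Omega>) = 0" for v
  proof -
    have inner: "(\<integral>n. \<delta> \<theta>' (x, n) * (\<phi> (x, n) \<bullet> v) \<partial>N) = 0" for x
    proof -
      have "(\<integral>n. \<delta> \<theta>' (x, n) \<partial>N) = 0"
        using bellman_residual_mean_zero[OF assms(1-5), of S R x]
        by (simp add: \<delta>_def u_def x'_def \<theta>'_def N_def F_def add.assoc case_prod_beta')
      then show ?thesis by (simp add: \<phi>_def)
    qed
    have "(\<integral>p. \<delta> \<theta>' p * (\<phi> p \<bullet> v) \<partial>\<Omega>) = (\<integral>x. (\<integral>n. \<delta> \<theta>' (x, n) * (\<phi> (x, n) \<bullet> v) \<partial>N) \<partial>\<mu>)"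
      using integral_fst'[of "\<lambda>p. \<delta> \<theta>' p * (\<phi> p \<bullet> v)"]
        square_integrable_mult_integrable[OF L2_\<delta>[of \<theta>'] L2_inner_\<phi>[of v]]
      by (simp add: \<Omega>_def)
    then show ?thesis by (simp add: inner)
  qed
  have h_inner: "h \<bullet> v = (\<integral>p. (\<xi> p - \<gamma> * \<xi>' p) * (\<phi> p \<bullet> v) \<partial>\<Omega>)" for v
  proof -
    have "h \<bullet> v = (\<integral>p. \<delta> \<theta> p * (\<phi> p \<bullet> v) \<partial>\<Omega>)"
      unfolding h using integral_inner_left[OF \<delta>\<phi>_int, of v] by simp
    also have "\<dots> = (\<integral>p. \<delta> \<theta>' p * (\<phi> p \<bullet> v) + (\<xi> p - \<gamma> * \<xi>' p) * (\<phi> p \<bullet> v) \<partial>\<Omega>)"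
      by (intro Bochner_Integration.integral_cong refl)
         (simp add: \<delta>_V \<xi>_def \<xi>'_def \<Delta>_def V_approx_diff algebra_simps)
    also have "\<dots> = (\<integral>p. \<delta> \<theta>' p * (\<phi> p \<bullet> v) \<partial>\<Omega>) + (\<integral>p. (\<xi> p - \<gamma> * \<xi>' p) * (\<phi> p \<bullet> v) \<partial>\<Omega>)"
      by (intro Bochner_Integration.integral_add square_integrable_mult_integrable L2_\<delta> L2_inner_\<phi>
          square_integrable_diff square_integrable_cmult L2_\<xi>)
    finally show ?thesis by (simp add: bellman)
  qed

  define e where "e = (\<integral>p. (\<xi> p)\<^sup>2 \<partial>\<Omega>)"
  define c where "c = (\<integral>p. \<xi> p * \<xi>' p \<partial>\<Omega>)"
  have \<xi>_sq: "integrable \<Omega> (\<lambda>p. (\<xi> p)\<^sup>2)" "integrable \<Omega> (\<lambda>p. (\<xi>' p)\<^sup>2)"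
    using L2_\<xi> by (auto simp: square_integrable_def)
  have \<xi>_mixed: "integrable \<Omega> (\<lambda>p. \<xi> p * \<xi>' p)"
    by (rule square_integrable_mult_integrable[OF L2_\<xi>])
  have e: "e = feature_second_moment D \<Delta>"
    using V_approx_second_moment[OF gauss_x, of \<Delta>]
    by (simp add: e_def \<xi>_def has_bochner_integral_iff)
  have e': "(\<integral>p. (\<xi>' p)\<^sup>2 \<partial>\<Omega>) = e"
    using V_approx_second_moment[OF gauss_x', of \<Delta>]
    by (simp add: e \<xi>'_def has_bochner_integral_iff)
  have e_\<mu>: "e = (\<integral>x. (V_approx x \<theta> - V_approx x \<theta>')\<^sup>2 \<partial>\<mu>)"
    using V_approx_second_moment[OF gauss_\<mu>, of \<Delta>]
    by (simp add: e \<Delta>_def V_approx_diff has_bochner_integral_iff)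
  have "0 \<le> e" by (simp add: e_def)
  have "c \<le> e"
  proof -
    have "2 * c \<le> (\<integral>p. (\<xi> p)\<^sup>2 + (\<xi>' p)\<^sup>2 \<partial>\<Omega>)"
      unfolding c_def
      by (subst integral_mult_right_zero[symmetric], intro integral_mono)
         (auto simp: \<xi>_sq \<xi>_mixed intro: sum_squares_bound[simplified mult.assoc])
    also have "\<dots> = e + e"
      by (simp add: \<xi>_sq e' e_def[symmetric])
    finally show ?thesis by simp
  qed
  have h\<Delta>: "h \<bullet> \<Delta> = e - \<gamma> * c"
  proof -
    have "h \<bullet> \<Delta> = (\<integral>p. (\<xi> p)\<^sup>2 - \<gamma> * (\<xi> p * \<xi>' p) \<partial>\<Omega>)"
      unfolding h_inner
      by (intro Bochner_Integration.integral_cong refl)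
         (simp add: \<phi>_def \<xi>_def V_approx_def power2_eq_square algebra_simps)
    then show ?thesis
      by (simp add: \<xi>_sq \<xi>_mixed e_def c_def)
  qed
  have h_norm: "(norm h)\<^sup>2 \<le> L * ((1 + \<gamma>\<^sup>2) * e - 2 * \<gamma> * c)"
  proof -
    define g where "g p = \<xi> p - \<gamma> * \<xi>' p" for p
    have L2_g: "square_integrable \<Omega> g"
      unfolding g_def[abs_def] by (intro square_integrable_diff square_integrable_cmult L2_\<xi>)
    then have g_sq: "integrable \<Omega> (\<lambda>p. (g p)\<^sup>2)" by (simp add: square_integrable_def)
    have norm_sq: "integrable \<Omega> (\<lambda>p. (norm (\<phi> p))\<^sup>2)"
      using \<phi>_norm by (simp add: has_bochner_integral_iff)
    have g: "(\<integral>p. (g p)\<^sup>2 \<partial>\<Omega>) = (1 + \<gamma>\<^sup>2) * e - 2 * \<gamma> * c"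
    proof -
      have "(\<integral>p. (g p)\<^sup>2 \<partial>\<Omega>) = (\<integral>p. (\<xi> p)\<^sup>2 - 2 * \<gamma> * (\<xi> p * \<xi>' p) + \<gamma>\<^sup>2 * (\<xi>' p)\<^sup>2 \<partial>\<Omega>)"
        by (intro Bochner_Integration.integral_cong refl)
           (simp add: g_def power2_eq_square algebra_simps)
      also have "\<dots> = e - 2 * \<gamma> * c + \<gamma>\<^sup>2 * e"
        by (simp add: \<xi>_sq \<xi>_mixed e' c_def flip: e_def)
      finally show ?thesis by (simp add: algebra_simps)
    qed
    \<comment> \<open>Young's inequality with weight \<open>L\<close> in place of Cauchy-Schwarz for integrals: the second term is absorbed on the left.\<close>
    have "2 * (norm h)\<^sup>2 = (\<integral>p. 2 * (g p * (\<phi> p \<bullet> h)) \<partial>\<Omega>)"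
      by (simp add: power2_norm_eq_inner h_inner g_def)
    also have "\<dots> \<le> (\<integral>p. L * (g p)\<^sup>2 + (norm h)\<^sup>2 / L * (norm (\<phi> p))\<^sup>2 \<partial>\<Omega>)"
    proof (intro integral_mono)
      show "integrable \<Omega> (\<lambda>p. 2 * (g p * (\<phi> p \<bullet> h)))"
        by (intro integrable_mult_right square_integrable_mult_integrable L2_g L2_inner_\<phi>)
      show "integrable \<Omega> (\<lambda>p. L * (g p)\<^sup>2 + (norm h)\<^sup>2 / L * (norm (\<phi> p))\<^sup>2)"
        by (intro Bochner_Integration.integrable_add integrable_mult_right g_sq norm_sq)
      fix p
      have "(\<phi> p \<bullet> h)\<^sup>2 \<le> (norm h)\<^sup>2 * (norm (\<phi> p))\<^sup>2"
        using Cauchy_Schwarz_ineq[of "\<phi> p" h] by (simp add: power2_norm_eq_inner mult.commute)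
      moreover have "0 \<le> (L * g p - \<phi> p \<bullet> h)\<^sup>2" by simp
      ultimately have "2 * (g p * (\<phi> p \<bullet> h)) * L \<le> L * L * (g p)\<^sup>2 + (norm h)\<^sup>2 * (norm (\<phi> p))\<^sup>2"
        by (simp add: power2_diff power_mult_distrib power2_eq_square[of L] algebra_simps)
      then show "2 * (g p * (\<phi> p \<bullet> h)) \<le> L * (g p)\<^sup>2 + (norm h)\<^sup>2 / L * (norm (\<phi> p))\<^sup>2"
        using L_pos by (simp add: field_simps)
    qed
    also have "\<dots> = L * (\<integral>p. (g p)\<^sup>2 \<partial>\<Omega>) + (norm h)\<^sup>2 / L * (\<integral>p. (norm (\<phi> p))\<^sup>2 \<partial>\<Omega>)"
      by (simp add: g_sq norm_sq)
    also have "\<dots> \<le> L * (\<integral>p. (g p)\<^sup>2 \<partial>\<Omega>) + (norm h)\<^sup>2 / L * L"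
      using \<phi>_norm L_ge L_pos
      by (intro add_left_mono mult_left_mono) (auto simp: has_bochner_integral_iff)
    finally show ?thesis
      using L_pos by (simp add: g)
  qed
  have "(norm (\<theta> - \<alpha> *\<^sub>R h - \<theta>'))\<^sup>2 = (norm \<Delta>)\<^sup>2 + (\<alpha>\<^sup>2 * (norm h)\<^sup>2 - 2 * \<alpha> * (h \<bullet> \<Delta>))"
  proof -
    have shift: "\<theta> - \<alpha> *\<^sub>R h - \<theta>' = \<Delta> - \<alpha> *\<^sub>R h" by (simp add: \<Delta>_def)
    show ?thesis
      unfolding shift power2_norm_eq_inner
      by (simp add: inner_diff_left inner_diff_right inner_commute[of \<Delta> h] power2_eq_square algebra_simps)
  qed
  also have "\<dots> \<le> (norm \<Delta>)\<^sup>2 - (1 - \<gamma>)\<^sup>2 / (2 * L) * e"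
    using td_descent_arithmetic[OF L_pos assms(3,4) \<open>0 \<le> e\<close> \<open>c \<le> e\<close> \<alpha> h_norm] by (simp add: h\<Delta>)
  finally show ?thesis
    by (simp add: h_def \<Delta>_def e_\<mu> \<mu>_def)
qed

lemma square_integrable_V_approx_state_dist:
  fixes A :: "real^'n^'n" and B :: "real^'d^'n" and D\<^sub>\<omega> :: "real^'n^'n" and K :: "real^'n^'d"
  assumes "sym_pos_def D\<^sub>\<omega>" and "\<sigma> > 0" and "stable_policy A B K"
  shows "square_integrable (state_dist A B \<sigma> D\<^sub>\<omega> K) (\<lambda>x. V_approx x \<theta>)"
  unfolding state_dist_def
  by (rule square_integrable_V_approx[OF gaussian_vector_gaussian[OF sym_pos_def_state_cov
        [OF assms(3) sym_pos_def_total_noise_cov[OF assms(1,2)]]]])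

section \<open>Convergence of the averaged iterates\<close>

theorem theorem3p4:
  fixes A :: "real^'n^'n" and B :: "real^'d^'n"
    and S :: "real^'n^'n" and R :: "real^'d^'d" and D\<^sub>\<omega> :: "real^'n^'n"
    and \<sigma> \<gamma> \<alpha> M\<^sub>\<theta> :: real
    and K :: "real^'n^'d" and N :: nat
    and \<theta> :: "nat \<Rightarrow> 'n feat" and \<theta>avg :: "'n feat"
  assumes "sym_pos_def S" and "sym_pos_def R" and "sym_pos_def D\<^sub>\<omega>"
    and "\<sigma> > 0" and "0 < \<gamma>" and "\<gamma> < 1"
    and "stable_policy A B K"
    and "N \<ge> 1"
    and "\<alpha> = (1 - \<gamma>) /
          (2 * (1 + (real CARD('n) + 2) * (frobenius_norm (state_cov A B \<sigma> D\<^sub>\<omega> K))\<^sup>2))"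
    and "\<forall>s\<in>{1..N - 1}. \<theta> s = \<theta> (s - 1) - \<alpha> *\<^sub>R semi_gradient A B S R \<sigma> \<gamma> D\<^sub>\<omega> K (\<theta> (s - 1))"
    and "\<theta>avg = (1 / real N) *\<^sub>R (\<Sum>s = 0..N - 1. \<theta> s)"
    and "M\<^sub>\<theta> > 0"
    and "norm (theta_star A B S R \<sigma> \<gamma> D\<^sub>\<omega> K) \<le> M\<^sub>\<theta>"
    and "\<forall>s\<in>{0..N - 1}. norm (\<theta> s) \<le> M\<^sub>\<theta>"
  shows "(\<integral>x. (V_approx x \<theta>avg - V_approx x (theta_star A B S R \<sigma> \<gamma> D\<^sub>\<omega> K))\<^sup>2
            \<partial>state_dist A B \<sigma> D\<^sub>\<omega> K)
         \<le> 8 * (1 + (real CARD('n) + 2) * (frobenius_norm (state_cov A B \<sigma> D\<^sub>\<omega> K))\<^sup>2) * M\<^sub>\<theta>\<^sup>2 /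
            ((1 - \<gamma>)\<^sup>2 * real N)"
proof -
  define L where "L = 1 + (real CARD('n) + 2) * (frobenius_norm (state_cov A B \<sigma> D\<^sub>\<omega> K))\<^sup>2"
  define \<theta>' where "\<theta>' = theta_star A B S R \<sigma> \<gamma> D\<^sub>\<omega> K"
  define \<mu> where "\<mu> = state_dist A B \<sigma> D\<^sub>\<omega> K"
  define \<beta> where "\<beta> = (1 - \<gamma>)\<^sup>2 / (2 * L)"
  define err where "err \<psi> = (\<integral>x. (V_approx x \<psi> - V_approx x \<theta>')\<^sup>2 \<partial>\<mu>)" for \<psi>
  have L_pos: "0 < L" by (simp add: L_def add_pos_nonneg)
  have \<beta>_pos: "0 < \<beta>" using L_pos assms(6) by (simp add: \<beta>_def)
  have N_pos: "0 < real N" using assms(8) by simp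
  have \<alpha>: "\<alpha> = (1 - \<gamma>) / (2 * L)" by (simp add: assms(9) L_def)
  define step where "step \<psi> = \<psi> - \<alpha> *\<^sub>R semi_gradient A B S R \<sigma> \<gamma> D\<^sub>\<omega> K \<psi>" for \<psi>
  have descent: "(norm (step \<psi> - \<theta>'))\<^sup>2 \<le> (norm (\<psi> - \<theta>'))\<^sup>2 - \<beta> * err \<psi>" for \<psi>
    using td_descent[OF assms(3-7) L_def \<alpha>, of \<psi> S R]
    by (simp add: step_def \<theta>'_def \<beta>_def err_def \<mu>_def)
  \<comment> \<open>For \<open>k = N\<close> the last term is one further update of \<open>\<theta> (N - 1)\<close>: the recursion does not determine \<open>\<theta> N\<close>.\<close>
  have telescope: "\<beta> * (\<Sum>s<k. err (\<theta> s)) \<le> (norm (\<theta> 0 - \<theta>'))\<^sup>2 - (norm ((if k = 0 then \<theta> 0 else step (\<theta> (k - 1))) - \<theta>'))\<^sup>2"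
    if "k \<le> N" for k
    using that
  proof (induction k)
    case (Suc k)
    have "\<theta> k = (if k = 0 then \<theta> 0 else step (\<theta> (k - 1)))"
      using assms(10) Suc.prems by (auto simp: step_def)
    with Suc descent[of "\<theta> k"] show ?case
      by (simp add: distrib_left)
  qed simp
  have "\<beta> * (\<Sum>s<N. err (\<theta> s)) \<le> (norm (\<theta> 0 - \<theta>'))\<^sup>2"
    using telescope[of N] by (smt (verit) order_refl zero_le_power2)
  also have "\<dots> \<le> (2 * M\<^sub>\<theta>)\<^sup>2"
  proof (rule power_mono)
    show "norm (\<theta> 0 - \<theta>') \<le> 2 * M\<^sub>\<theta>"
      using norm_triangle_ineq4[of "\<theta> 0" \<theta>'] assms(13,14) by (force simp: \<theta>'_def)
  qed simp
  finally have total: "(\<Sum>s<N. err (\<theta> s)) \<le> 8 * L * M\<^sub>\<theta>\<^sup>2 / (1 - \<gamma>)\<^sup>2"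
    using \<beta>_pos L_pos assms(6) by (simp add: \<beta>_def field_simps)

  have L2: "square_integrable \<mu> (\<lambda>x. V_approx x \<psi>)" for \<psi>
    unfolding \<mu>_def by (rule square_integrable_V_approx_state_dist[OF assms(3,4,7)])
  have sq_int: "integrable \<mu> (\<lambda>x. (V_approx x \<psi> - V_approx x \<theta>')\<^sup>2)" for \<psi>
    using square_integrable_diff[OF L2[of \<psi>] L2[of \<theta>']] by (simp add: square_integrable_def)
  have range: "{0..N - 1} = {..<N}" using assms(8) by auto
  \<comment> \<open>\<open>V_approx x\<close> is linear in the parameter, so convexity of the square applies pointwise.\<close>
  have jensen: "(V_approx x \<theta>avg - V_approx x \<theta>')\<^sup>2 \<le> (\<Sum>s<N. (V_approx x (\<theta> s) - V_approx x \<theta>')\<^sup>2) / real N" for x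
  proof -
    have avg: "V_approx x \<theta>avg - V_approx x \<theta>' = (\<Sum>s<N. V_approx x (\<theta> s) - V_approx x \<theta>') / real N"
      using N_pos by (simp add: assms(11) range[simplified] V_approx_scaleR V_approx_sum sum_subtractf field_simps)
    have "(\<Sum>s<N. V_approx x (\<theta> s) - V_approx x \<theta>')\<^sup>2
        \<le> real N * (\<Sum>s<N. (V_approx x (\<theta> s) - V_approx x \<theta>')\<^sup>2)"
      using Cauchy_Schwarz_ineq_sum[of "\<lambda>_. 1" "\<lambda>s. V_approx x (\<theta> s) - V_approx x \<theta>'" "{..<N}"] by simp
    then have "(\<Sum>s<N. V_approx x (\<theta> s) - V_approx x \<theta>')\<^sup>2 / (real N)\<^sup>2
        \<le> real N * (\<Sum>s<N. (V_approx x (\<theta> s) - V_approx x \<theta>')\<^sup>2) / (real N)\<^sup>2"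
      by (rule divide_right_mono) simp
    then show ?thesis
      using N_pos by (simp add: avg power_divide power2_eq_square)
  qed
  have "err \<theta>avg \<le> (\<integral>x. (\<Sum>s<N. (V_approx x (\<theta> s) - V_approx x \<theta>')\<^sup>2) / real N \<partial>\<mu>)"
    unfolding err_def
    by (intro integral_mono sq_int integrable_divide_zero Bochner_Integration.integrable_sum jensen)
  also have "\<dots> = (\<Sum>s<N. err (\<theta> s)) / real N"
    by (simp add: err_def sq_int)
  also have "\<dots> \<le> 8 * L * M\<^sub>\<theta>\<^sup>2 / (1 - \<gamma>)\<^sup>2 / real N"
    using total N_pos by (intro divide_right_mono) auto
  finally show ?thesis
    by (simp add: err_def \<mu>_def \<theta>'_def L_def)
qed

end
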